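(* Let $N\ge 2$, let $M$ be a symmetric positive definite real $N\times N$ matrix, and let $H(\xi)=\sqrt{\langle M\xi,\xi\rangle}$ for $\xi\in\mathbb{R}^N$. Let $f\in L^2_{loc}(\mathbb{R}^N)$ and let $u\in H^1_{loc}(\mathbb{R}^N)$ be a locally bounded weak solution of $-\Delta^H u=f$ in $\mathbb{R}^N$. Define $T_H(y)=\frac{\nabla H(y)}{H(y)}$ and $$\hat u(y)=\frac{u(T_H(y))}{H(y)^{N-2}},\qquad y\in\mathbb{R}^N\setminus\{0\}.$$ Then $\hat u$ belongs to $D^{1,2}$ far from the origin, and $\hat u$ is a weak solution of the dual equation $$-\Delta^{H^\circ}\hat u=\frac{f\circ T_H}{H^{N+2}}\qquad\text{in }\mathbb{R}^N\setminus\{0\},$$ where $H^\circ$ is the dual norm of $H$.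
   Context: $\langle\cdot,\cdot\rangle$ is the Euclidean inner product on $\mathbb{R}^N$. The dual norm of $H$ is $H^\circ(x)=\sup\{\langle \xi,x\rangle : H(\xi)\le 1\}$; for $H(\xi)=\sqrt{\langle M\xi,\xi\rangle}$ one has $H^\circ(x)=\sqrt{\langle M^{-1}x,x\rangle}$. For a norm $K\in C^2(\mathbb{R}^N\setminus\{0\})$, the Finsler Laplacian is $\Delta^K v=\operatorname{div}(K(\nabla v)\nabla K(\nabla v))$, where $K(\eta)\nabla K(\eta)$ is understood to be $0$ at $\eta=0$. Given an open set $\Omega\subseteq\mathbb{R}^N$ and $h\in L^2_{loc}(\Omega)$, a function $v\in H^1_{loc}(\Omega)$ is a weak solution of $-\Delta^K v=h$ in $\Omega$ if $$\int_\Omega K(\nabla v)\langle\nabla K(\nabla v),\nabla\varphi\rangle\,dx=\int_\Omega h\,\varphi\,dx\qquad\forall\,\varphi\in C^1_c(\Omega).$$ "$v$ belongs to $D^{1,2}$ far from the origin" means that for every $R>0$, with $\Omega_R=\{y\in\mathbb{R}^N:|y|>R\}$, $v$ is weakly differentiable in $\Omega_R$ with $\nabla v\in L^2(\Omega_R)$ and, when $N\ge 3$, also $v\in L^{2N/(N-2)}(\Omega_R)$. *)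

theory Defs
  imports "HOL-Analysis.Analysis"
begin

definition gradient :: "('a::euclidean_space \<Rightarrow> real) \<Rightarrow> 'a \<Rightarrow> 'a" where
  "gradient f x = (THE D. GDERIV f x :> D)"

lemma gradient_eqI:
  assumes "GDERIV f x :> D"
  shows "gradient f x = D"
  unfolding gradient_def
proof (rule the_equality)
  fix D' assume "GDERIV f x :> D'"
  then have "(\<lambda>h. h \<bullet> D') = (\<lambda>h. h \<bullet> D)"
    using assms unfolding gderiv_def by (rule has_derivative_unique)
  then have "h \<bullet> D' = h \<bullet> D" for h
    by (rule fun_cong)
  then show "D' = D"
    by (simp add: euclidean_eq_iff [of D'] inner_commute)
qed (fact assms)

definition C1_c :: "'a::euclidean_space set \<Rightarrow> ('a \<Rightarrow> real) set" where
  "C1_c \<Omega> = {\<phi>. (\<forall>x. \<phi> differentiable (at x)) \<and> continuous_on UNIV (gradient \<phi>) \<and>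
     compact (closure {x. \<phi> x \<noteq> 0}) \<and> closure {x. \<phi> x \<noteq> 0} \<subseteq> \<Omega>}"

(* Elements of the function spaces below are total functions; only their values (up to null sets)
   on the set in question matter. The exponent p is meant to be positive and finite. *)

definition Lp :: "real \<Rightarrow> 'a::euclidean_space set \<Rightarrow> ('a \<Rightarrow> 'b::euclidean_space) set" where
  "Lp p S = {f. f \<in> borel_measurable (lebesgue_on S) \<and>
     set_integrable lebesgue S (\<lambda>x. norm (f x) powr p)}"

definition Lp_loc :: "real \<Rightarrow> 'a::euclidean_space set \<Rightarrow> ('a \<Rightarrow> 'b::euclidean_space) set" where
  "Lp_loc p \<Omega> = {f. \<forall>S. compact S \<and> S \<subseteq> \<Omega> \<longrightarrow> f \<in> Lp p S}"

(* Local boundedness is understood almost everywhere, as usual for Sobolev functions. *)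
definition locally_bounded :: "'a::euclidean_space set \<Rightarrow> ('a \<Rightarrow> real) \<Rightarrow> bool" where
  "locally_bounded \<Omega> f \<longleftrightarrow>
     (\<forall>S. compact S \<and> S \<subseteq> \<Omega> \<longrightarrow> (\<exists>C. AE x in lebesgue. x \<in> S \<longrightarrow> \<bar>f x\<bar> \<le> C))"

(* Weak gradients are determined only up to null sets, hence the relational formulation.
   As in Brezis' textbook, the test functions are of class C^1 with compact support. *)
definition has_weak_gradient ::
    "'a::euclidean_space set \<Rightarrow> ('a \<Rightarrow> real) \<Rightarrow> ('a \<Rightarrow> 'a) \<Rightarrow> bool" where
  "has_weak_gradient \<Omega> v g \<longleftrightarrow> v \<in> Lp_loc 1 \<Omega> \<and> g \<in> Lp_loc 1 \<Omega> \<and>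
     (\<forall>\<phi>\<in>C1_c \<Omega>. (LINT x:\<Omega>|lebesgue. v x *\<^sub>R gradient \<phi> x)
                = - (LINT x:\<Omega>|lebesgue. \<phi> x *\<^sub>R g x))"

definition H1_loc :: "'a::euclidean_space set \<Rightarrow> ('a \<Rightarrow> real) set" where
  "H1_loc \<Omega> = {v. v \<in> Lp_loc 2 \<Omega> \<and> (\<exists>g. has_weak_gradient \<Omega> v g \<and> g \<in> Lp_loc 2 \<Omega>)}"

definition D12_far_from_origin :: "('a::euclidean_space \<Rightarrow> real) \<Rightarrow> bool" where
  "D12_far_from_origin v \<longleftrightarrow>
     (\<forall>R>0. (\<exists>g. has_weak_gradient {y. norm y > R} v g \<and> g \<in> Lp 2 {y. norm y > R}) \<and>
        (DIM('a) \<ge> 3 \<longrightarrow> v \<in> Lp (2 * real DIM('a) / (real DIM('a) - 2)) {y. norm y > R}))"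

definition dual_norm :: "('a::euclidean_space \<Rightarrow> real) \<Rightarrow> 'a \<Rightarrow> real" where
  "dual_norm H x = (SUP \<xi>\<in>{\<xi>. H \<xi> \<le> 1}. \<xi> \<bullet> x)"

(* The vector field whose divergence, taken along the gradient of v, is the Finsler Laplacian
   of v associated with the norm K. *)
definition finsler_field :: "('a::euclidean_space \<Rightarrow> real) \<Rightarrow> 'a \<Rightarrow> 'a" where
  "finsler_field K \<eta> = (if \<eta> = 0 then 0 else K \<eta> *\<^sub>R gradient K \<eta>)"

(* v is a weak solution in \<Omega> of: minus the Finsler Laplacian of v equals h.
   The requirements that h be in L^2_loc and v in H^1_loc are part of the notion; they make
   both integrals converge. *)
definition weak_solution ::
    "('a::euclidean_space \<Rightarrow> real) \<Rightarrow> 'a set \<Rightarrow> ('a \<Rightarrow> real) \<Rightarrow> ('a \<Rightarrow> real) \<Rightarrow> bool" where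
  "weak_solution K \<Omega> h v \<longleftrightarrow> h \<in> Lp_loc 2 \<Omega> \<and> v \<in> H1_loc \<Omega> \<and>
     (\<exists>g. has_weak_gradient \<Omega> v g \<and> g \<in> Lp_loc 2 \<Omega> \<and>
        (\<forall>\<phi>\<in>C1_c \<Omega>. (LINT x:\<Omega>|lebesgue. finsler_field K (g x) \<bullet> gradient \<phi> x)
                   = (LINT x:\<Omega>|lebesgue. h x * \<phi> x)))"

definition T_map :: "('a::euclidean_space \<Rightarrow> real) \<Rightarrow> 'a \<Rightarrow> 'a" where
  "T_map H y = gradient H y /\<^sub>R H y"

(* The values at y = 0 of this function and of T_map H are irrelevant. The exponent is a natural
   number subtraction, so this is meant for dimension at least 2. *)
definition kelvin_transform :: "('a::euclidean_space \<Rightarrow> real) \<Rightarrow> ('a \<Rightarrow> real) \<Rightarrow> 'a \<Rightarrow> real" where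
  "kelvin_transform H u y = u (T_map H y) / H y ^ (DIM('a) - 2)"

end

theory Submission
  imports Defs
begin

text \<open>
  For \<open>H \<xi> = sqrt (M \<xi> \<bullet> \<xi>)\<close> the field \<open>H \<nabla>H\<close> is linear, so both Finsler Laplacians are linear
  operators, \<open>div (M \<nabla>u)\<close> and \<open>div (M\<^sup>-\<^sup>1 \<nabla>v)\<close>, and \<open>T y = M y / (H y)\<^sup>2\<close> is an anisotropic inversion of
  the punctured space whose inverse \<open>S\<close> is the inversion of the dual norm. The derivative of \<open>T\<close> is
  conformal, \<open>DT M\<^sup>-\<^sup>1 DT = M / H\<^sup>4\<close>. The change of variables \<open>y = S x\<close> turns a test function \<open>\<phi>\<close> of the
  transformed problem into \<open>\<psi> = \<phi> \<circ> S\<close>, again a test function on the punctured space; testing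
  the weak gradient of \<open>u\<close> with \<open>\<psi>\<close> times powers of the dual norm gives the weak gradient of the Kelvin
  transform, and testing the equation with \<open>\<psi> / q\<^bsup>N-2\<^esup>\<close>, where \<open>q\<close> is the dual norm, gives the dual
  equation. Far from the origin, the same change of variables leads to a bounded region, where
  \<open>u\<close> is bounded and \<open>\<bar>\<nabla>u\<bar>\<^sup>2\<close> is integrable; the only further term is a multiple of
  \<open>(N - 2)\<^sup>2 u\<^sup>2 / \<bar>x\<bar>\<^sup>2\<close>, which is absent for \<open>N = 2\<close> and integrable for \<open>N \<ge> 3\<close>.
\<close>

section \<open>Change of variables in Euclidean spaces\<close>

text \<open>No approximation by smooth functions is used to compose a Sobolev function with a
  diffeomorphism. The expected gradient \<open>gK\<close> is written down by the formal chain rule,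
  and the weak identities are verified by moving the inversion onto the test functions, which are
  C^1. The obstacle is that a constant direction \<open>e\<close> becomes a vector field after the
  change of variables, while a weak gradient is tested in constant directions only. That field
  combines the constant vector \<open>A e\<close> and the position \<open>x\<close>, each with a
  scalar weight, so the one further identity required is integration by parts along
  \<open>x\<close>, \<open>weak_gradient_position\<close>. The weight \<open>1 / q^(N-2)\<close>
  suits the equation because \<open>A\<close> applied to its gradient is
  \<open>-(N-2) x / q^N\<close>, which has no divergence away from the origin; this is why the
  zero-order terms cancel. The origin itself causes no trouble: test functions vanish near it, and
  the conventions for division by zero give it harmless values.\<close>

text \<open>The library states the change of variables formula for \<open>real ^ 'm\<close> with \<open>'m\<close> of class
  \<open>wellorder\<close> only, which an arbitrary finite index type is not. It is transported to every
  Euclidean space by coordinates indexed by an initial segment of the natural numbers.\<close>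

typedef (overloaded) 'a dim_index = "{..<DIM('a::euclidean_space)}"
  by (auto intro!: exI[of _ 0])

instantiation dim_index :: (euclidean_space) wellorder
begin

definition less_eq_dim_index :: "'a dim_index \<Rightarrow> 'a dim_index \<Rightarrow> bool" where
  "i \<le> j \<longleftrightarrow> Rep_dim_index i \<le> Rep_dim_index j"

definition less_dim_index :: "'a dim_index \<Rightarrow> 'a dim_index \<Rightarrow> bool" where
  "i < j \<longleftrightarrow> Rep_dim_index i < Rep_dim_index j"

instance
proof
  fix P :: "'a dim_index \<Rightarrow> bool" and i :: "'a dim_index"
  assume step: "\<And>i. (\<And>j. j < i \<Longrightarrow> P j) \<Longrightarrow> P i"
  show "P i"
    by (induction i rule: measure_induct_rule[of Rep_dim_index])
       (use step less_dim_index_def in blast)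
qed (auto simp: less_eq_dim_index_def less_dim_index_def Rep_dim_index_inject)

end

instance dim_index :: (euclidean_space) finite
proof
  have "(UNIV :: 'a dim_index set) = Abs_dim_index ` {..<DIM('a)}"
    using type_definition.Abs_image[OF type_definition_dim_index] by auto
  then show "finite (UNIV :: 'a dim_index set)"
    by (metis finite_imageI finite_lessThan)
qed

lemma CARD_dim_index: "CARD('a::euclidean_space dim_index) = DIM('a)"
  using type_definition.card[OF type_definition_dim_index] by simp

definition basis_at :: "'a::euclidean_space dim_index \<Rightarrow> 'a" where
  "basis_at = (SOME \<beta>. bij_betw \<beta> UNIV Basis)"

lemma bij_betw_basis_at: "bij_betw (basis_at :: 'a::euclidean_space dim_index \<Rightarrow> 'a) UNIV Basis"
proof -
  have "\<exists>\<beta> :: 'a dim_index \<Rightarrow> 'a. bij_betw \<beta> UNIV Basis"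
    by (intro finite_same_card_bij) (auto simp: CARD_dim_index)
  then show ?thesis
    unfolding basis_at_def by (rule someI_ex)
qed

lemma basis_at_in_Basis [simp]: "basis_at i \<in> Basis"
  using bij_betw_basis_at by (auto simp: bij_betw_def)

lemma sum_basis_at: "(\<Sum>i\<in>UNIV. f (basis_at i)) = (\<Sum>b\<in>Basis. f b)"
  using sum.reindex_bij_betw[OF bij_betw_basis_at] .

lemma prod_basis_at: "(\<Prod>i\<in>UNIV. f (basis_at i)) = (\<Prod>b\<in>Basis. f b)"
  using prod.reindex_bij_betw[OF bij_betw_basis_at] .

definition coords :: "'a::euclidean_space \<Rightarrow> real ^ 'a dim_index" where
  "coords x = (\<chi> i. x \<bullet> basis_at i)"

definition of_coords :: "real ^ 'a::euclidean_space dim_index \<Rightarrow> 'a" where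
  "of_coords z = (\<Sum>i\<in>UNIV. z $ i *\<^sub>R basis_at i)"

lemma basis_at_inner: "basis_at i \<bullet> basis_at j = (if i = j then 1 else 0)"
  using bij_betw_basis_at by (auto simp: inner_Basis bij_betw_def inj_on_def)

lemma of_coords_coords [simp]: "of_coords (coords x) = x"
  by (simp add: of_coords_def coords_def sum_basis_at[of "\<lambda>b. (x \<bullet> b) *\<^sub>R b"] euclidean_representation)

lemma of_coords_inner [simp]: "of_coords z \<bullet> basis_at i = z $ i"
  by (simp add: of_coords_def inner_sum_left basis_at_inner if_distrib cong: if_cong)

lemma coords_of_coords [simp]: "coords (of_coords z) = z"
  by (simp add: coords_def vec_eq_iff)

lemma linear_coords: "linear coords"
  by (rule linearI) (auto simp: coords_def vec_eq_iff inner_add_left)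

lemma linear_of_coords: "linear of_coords"
  by (rule linearI) (auto simp: of_coords_def scaleR_add_left sum.distrib scaleR_right.sum)

lemma bounded_linear_coords: "bounded_linear coords"
  using linear_coords linear_conv_bounded_linear by blast

lemma bounded_linear_of_coords: "bounded_linear of_coords"
  using linear_of_coords linear_conv_bounded_linear by blast

lemma coords_measurable_borel: "coords \<in> borel_measurable borel"
  by (intro borel_measurable_continuous_onI linear_continuous_on bounded_linear_coords)

text \<open>The measure is determined by the volumes of boxes. The preimage of a box under
  \<open>coords\<close> is a box with the same edges under other labels, so the product of the edge
  lengths is unchanged.\<close>

lemma distr_coords_lborel: "distr lborel borel coords = lborel"
proof (rule lborel_eqI[symmetric])
  fix l u :: "real ^ 'a dim_index"
  assume lu: "\<And>b. b \<in> Basis \<Longrightarrow> l \<bullet> b \<le> u \<bullet> b"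
  have "coords -` box l u = box (of_coords l) (of_coords u)"
  proof -
    have "x \<in> box (of_coords l) (of_coords u) \<longleftrightarrow> coords x \<in> box l u" for x :: 'a
    proof -
      have "x \<in> box (of_coords l) (of_coords u) \<longleftrightarrow>
          (\<forall>i. of_coords l \<bullet> basis_at i < x \<bullet> basis_at i \<and> x \<bullet> basis_at i < of_coords u \<bullet> basis_at i)"
        using bij_betw_basis_at unfolding mem_box bij_betw_def by (metis (no_types, lifting) rangeE rangeI)
      also have "\<dots> \<longleftrightarrow> coords x \<in> box l u"
        by (simp add: mem_box_cart coords_def)
      finally show ?thesis .
    qed
    then show ?thesis by auto
  qed
  moreover have "of_coords l \<bullet> b \<le> of_coords u \<bullet> b" if b: "b \<in> Basis" for b
  proof -
    obtain i where "b = basis_at i"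
      using b bij_betw_imp_surj_on[OF bij_betw_basis_at] by blast
    then show ?thesis
      using lu[of "axis i 1"]
      by (simp add: inner_axis axis_in_Basis_iff)
  qed
  ultimately have "emeasure (distr lborel borel coords) (box l u) =
      ennreal (\<Prod>b\<in>Basis. (of_coords u - of_coords l) \<bullet> b)"
    using coords_measurable_borel by (subst emeasure_distr) (auto simp: emeasure_lborel_box)
  also have "(\<Prod>b\<in>Basis. (of_coords u - of_coords l) \<bullet> b) = (\<Prod>i\<in>UNIV. (u - l) $ i)"
    by (simp add: prod_basis_at[symmetric] inner_diff_left)
  also have "\<dots> = (\<Prod>b\<in>Basis. (u - l) \<bullet> b)"
  proof -
    have "bij_betw (\<lambda>i. axis i 1 :: real ^ 'a dim_index) UNIV Basis"
      by (auto simp: bij_betw_def inj_on_def axis_eq_axis Basis_vec_def)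
    from prod.reindex_bij_betw[OF this, of "\<lambda>b. (u - l) \<bullet> b"] show ?thesis
      by (simp add: inner_axis)
  qed
  finally show "emeasure (distr lborel borel coords) (box l u) = ennreal (\<Prod>b\<in>Basis. (u - l) \<bullet> b)" .
qed auto

lemma distr_coords_lebesgue: "distr lebesgue lebesgue (coords :: 'a::euclidean_space \<Rightarrow> _) = lebesgue"
proof -
  have *: "coords \<in> (lebesgue :: 'a measure) \<rightarrow>\<^sub>M lborel"
    using coords_measurable_borel by (auto intro: measurable_completion)
  have "distr lebesgue lborel (coords :: 'a \<Rightarrow> _) = lborel"
    using distr_completion[of coords lborel "lborel :: (real ^ 'a dim_index) measure"] 
      coords_measurable_borel distr_coords_lborel[where 'a='a]
    by (metis (no_types, lifting) distr_cong measurable_lborel1 measurable_lborel2 sets_lborel)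
  then show ?thesis
    using completion.completion_distr_eq[OF *] by simp
qed

text \<open>Continuity only controls preimages of Borel sets. For Lebesgue sets the preimage is read
  as the image under the linear inverse, because differentiable maps into a space of no smaller
  dimension send Lebesgue sets to Lebesgue sets.\<close>

lemma measurable_coords: "coords \<in> lebesgue \<rightarrow>\<^sub>M lebesgue"
proof -
  have "coords -` A \<in> sets lebesgue" if A: "A \<in> sets lebesgue" for A :: "(real ^ 'a dim_index) set"
  proof -
    have "of_coords ` A = coords -` A"
      by (metis (no_types, lifting) coords_of_coords of_coords_coords image_iff set_eq_iff vimage_eq)
    moreover have "of_coords ` A \<in> sets lebesgue"
      by (rule differentiable_image_in_sets_lebesgue[OF A])
        (auto simp: CARD_dim_index bounded_linear_of_coords linear_of_coords linear_imp_differentiable_on)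
    ultimately show ?thesis by simp
  qed
  then show ?thesis by (auto intro: measurableI)
qed

section \<open>Determinants of endomorphisms and the Jacobian formula\<close>

definition linear_det :: "('a::euclidean_space \<Rightarrow> 'a) \<Rightarrow> real" where
  "linear_det L = det (matrix (coords \<circ> L \<circ> of_coords))"

lemma linear_conj_coords: "linear L \<Longrightarrow> linear (coords \<circ> L \<circ> of_coords)"
  by (intro linear_compose linear_coords linear_of_coords)

lemma linear_det_compose:
  fixes L K :: "'a::euclidean_space \<Rightarrow> 'a"
  assumes "linear L" "linear K"
  shows "linear_det (L \<circ> K) = linear_det L * linear_det K"
proof -
  have "coords \<circ> (L \<circ> K) \<circ> of_coords = (coords \<circ> L \<circ> of_coords) \<circ> (coords \<circ> K \<circ> of_coords)"
    by (simp add: fun_eq_iff)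
  then show ?thesis
    using assms by (simp add: linear_det_def matrix_compose linear_conj_coords det_mul)
qed

lemma linear_det_scaleR: "linear_det (\<lambda>x :: 'a::euclidean_space. c *\<^sub>R x) = c ^ DIM('a)"
proof -
  have "coords \<circ> (\<lambda>x :: 'a. c *\<^sub>R x) \<circ> of_coords = (*\<^sub>R) c"
    by (simp add: fun_eq_iff linear_cmul[OF linear_coords])
  then show ?thesis
    by (simp add: linear_det_def CARD_dim_index)
qed

lemma linear_det_id: "linear_det (\<lambda>x. x) = 1"
  using linear_det_scaleR[of 1] by simp

lemma coords_eq_iff: "coords x = coords y \<longleftrightarrow> x = y"
  by (metis of_coords_coords)

text \<open>Passing through \<open>real ^ 1\<close> gives scalar functions the vector-valued form of
  the formula. Nothing is assumed about measurability or integrability of \<open>F\<close>, which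
  spares side conditions in every later substitution.\<close>

lemma change_of_variables_coords:
  fixes F :: "real ^ 'n::{finite,wellorder} \<Rightarrow> real"
  assumes "S \<in> sets lebesgue"
    and "\<And>x. x \<in> S \<Longrightarrow> (g has_derivative g' x) (at x within S)" and "inj_on g S"
  shows "set_integrable lebesgue (g ` S) F \<longleftrightarrow>
      set_integrable lebesgue S (\<lambda>x. \<bar>det (matrix (g' x))\<bar> * F (g x))"
    and "(LINT x:g ` S|lebesgue. F x) = (LINT x:S|lebesgue. \<bar>det (matrix (g' x))\<bar> * F (g x))"
proof -
  let ?F = "\<lambda>x. vec (F x) :: real ^ 1"
  have vec: "set_integrable lebesgue A (\<lambda>x. vec (G x) :: real ^ 1) \<longleftrightarrow> set_integrable lebesgue A G"
    for G :: "real ^ 'n::{finite,wellorder} \<Rightarrow> real" and A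
    by (simp add: absolutely_integrable_on_1_iff)
  have *: "\<bar>c\<bar> *\<^sub>R (vec t :: real ^ 1) = vec (\<bar>c\<bar> * t)" for c t
    by (simp add: vec_eq_iff)
  show iff: "set_integrable lebesgue (g ` S) F \<longleftrightarrow>
      set_integrable lebesgue S (\<lambda>x. \<bar>det (matrix (g' x))\<bar> * F (g x))"
    using absolutely_integrable_change_of_variables[OF assms, of ?F] by (simp only: vec *)
  have int: "(LINT x:A|lebesgue. G x) = integral A (\<lambda>x. vec (G x) :: real ^ 1) $ 1"
    if G: "set_integrable lebesgue A G" for G :: "real ^ 'n::{finite,wellorder} \<Rightarrow> real" and A
  proof -
    have "(\<lambda>x. vec (G x) :: real ^ 1) integrable_on A"
      using G vec set_lebesgue_integral_eq_integral(1) by blast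
    then have "integral A (\<lambda>x. vec (G x) :: real ^ 1) $ 1 = integral A (\<lambda>x. (vec (G x) :: real ^ 1) $ 1)"
      by (rule integral_component_eq_cart[symmetric])
    then show ?thesis
      using set_lebesgue_integral_eq_integral(2)[OF G] by simp
  qed
  show "(LINT x:g ` S|lebesgue. F x) = (LINT x:S|lebesgue. \<bar>det (matrix (g' x))\<bar> * F (g x))"
  proof (cases "set_integrable lebesgue (g ` S) F")
    case True
    then have "integral (g ` S) ?F = integral S (\<lambda>x. \<bar>det (matrix (g' x))\<bar> *\<^sub>R ?F (g x))"
      by (intro integral_change_of_variables assms) (auto simp: vec)
    with True iff show ?thesis
      by (simp add: int * )
  next
    \<comment> \<open>Neither side is integrable, so both integrals have the default value
      0.\<close>
    case False
    then show ?thesis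
      using iff by (simp add: set_lebesgue_integral_def set_integrable_def not_integrable_integral_eq)
  qed
qed

lemma measurable_of_coords: "of_coords \<in> lebesgue \<rightarrow>\<^sub>M lebesgue"
proof -
  have "of_coords -` A \<in> sets lebesgue" if A: "A \<in> sets lebesgue" for A :: "'a set"
  proof -
    have "coords ` A = of_coords -` A"
      by (metis (no_types, lifting) coords_of_coords of_coords_coords image_iff set_eq_iff vimage_eq)
    moreover have "coords ` A \<in> sets lebesgue"
      by (rule differentiable_image_in_sets_lebesgue[OF A])
        (auto simp: CARD_dim_index linear_coords linear_imp_differentiable_on)
    ultimately show ?thesis by simp
  qed
  then show ?thesis by (auto intro: measurableI)
qed

text \<open>Since \<open>coords\<close> and its inverse both respect Lebesgue sets, \<open>Z\<close>
  and its composition with \<open>coords\<close> are measurable together. If they are not, both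
  integrability claims fail and both integrals are 0, so \<open>Z\<close> may be arbitrary.\<close>

lemma lebesgue_coords:
  fixes Z :: "real ^ 'a::euclidean_space dim_index \<Rightarrow> real"
  shows "integrable lebesgue (\<lambda>x. Z (coords x)) \<longleftrightarrow> integrable lebesgue Z"
    and "integral\<^sup>L lebesgue (\<lambda>x. Z (coords x)) = integral\<^sup>L lebesgue Z"
proof -
  have meas: "(\<lambda>x. Z (coords x)) \<in> borel_measurable lebesgue \<longleftrightarrow> Z \<in> borel_measurable lebesgue"
  proof
    assume "Z \<in> borel_measurable lebesgue"
    then show "(\<lambda>x. Z (coords x)) \<in> borel_measurable lebesgue"
      by (rule measurable_compose[OF measurable_coords])
  next
    assume "(\<lambda>x. Z (coords x)) \<in> borel_measurable lebesgue"
    from measurable_compose[OF measurable_of_coords this]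
    show "Z \<in> borel_measurable lebesgue" by simp
  qed
  show iff: "integrable lebesgue (\<lambda>x. Z (coords x)) \<longleftrightarrow> integrable lebesgue Z"
  proof (cases "Z \<in> borel_measurable lebesgue")
    case True
    then show ?thesis
      using integrable_distr_eq[OF measurable_coords, of Z] by (simp add: distr_coords_lebesgue)
  next
    case False
    then show ?thesis
      using meas borel_measurable_integrable by blast
  qed
  show "integral\<^sup>L lebesgue (\<lambda>x. Z (coords x)) = integral\<^sup>L lebesgue Z"
  proof (cases "Z \<in> borel_measurable lebesgue")
    case True
    then show ?thesis
      using integral_distr[OF measurable_coords, of Z] by (simp add: distr_coords_lebesgue)
  next
    case False
    then show ?thesis
      using meas iff borel_measurable_integrable[of lebesgue Z] by (auto simp: not_integrable_integral_eq)
  qed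
qed

lemma euclidean_change_of_variables:
  fixes F :: "'a::euclidean_space \<Rightarrow> real"
  assumes S: "S \<in> sets lebesgue"
    and der: "\<And>x. x \<in> S \<Longrightarrow> (g has_derivative g' x) (at x within S)" and inj: "inj_on g S"
  shows "set_integrable lebesgue (g ` S) F \<longleftrightarrow>
      set_integrable lebesgue S (\<lambda>x. \<bar>linear_det (g' x)\<bar> * F (g x))"
    and "(LINT x:g ` S|lebesgue. F x) = (LINT x:S|lebesgue. \<bar>linear_det (g' x)\<bar> * F (g x))"
proof -
  define G where "G = coords \<circ> g \<circ> of_coords"
  define G' where "G' z = coords \<circ> g' (of_coords z) \<circ> of_coords" for z
  let ?S = "coords ` S"
  have S': "?S \<in> sets lebesgue"
    by (rule differentiable_image_in_sets_lebesgue[OF S])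
      (auto simp: CARD_dim_index linear_coords linear_imp_differentiable_on)
  have der': "(G has_derivative G' z) (at z within ?S)" if "z \<in> ?S" for z
  proof -
    have of: "of_coords ` ?S = S"
      by (simp add: image_image)
    have "(g has_derivative g' (of_coords z)) (at (of_coords z) within of_coords ` ?S)"
      using that der by (auto simp: image_image)
    then have "((g \<circ> of_coords) has_derivative (g' (of_coords z) \<circ> of_coords)) (at z within ?S)"
      by (intro diff_chain_within bounded_linear_imp_has_derivative bounded_linear_of_coords)
    then show ?thesis
      unfolding G_def G'_def comp_assoc
      by (rule diff_chain_within) (intro bounded_linear_imp_has_derivative bounded_linear_coords)
  qed
  have inj': "inj_on G ?S"
    using inj by (auto simp: inj_on_def G_def coords_eq_iff)
  have img: "G ` ?S = coords ` g ` S"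
    by (simp add: G_def image_comp comp_def)
  have "coords x \<in> coords ` A \<longleftrightarrow> x \<in> A" for x :: 'a and A
    by (auto simp: coords_eq_iff)
  then have [simp]: "indicat_real (coords ` A) (coords x) = indicator A x" for x :: 'a and A
    by (simp add: indicator_def)
  let ?L = "\<lambda>z. indicat_real (coords ` g ` S) z *\<^sub>R (F \<circ> of_coords) z"
  let ?R = "\<lambda>z. indicat_real (coords ` S) z *\<^sub>R (\<bar>det (matrix (G' z))\<bar> * (F \<circ> of_coords) (G z))"
  have "integrable lebesgue ?L \<longleftrightarrow> integrable lebesgue ?R"
    using change_of_variables_coords(1)[OF S' _ inj', of G' "F \<circ> of_coords"] der'
    unfolding set_integrable_def img by blast
  then show "set_integrable lebesgue (g ` S) F \<longleftrightarrow>
      set_integrable lebesgue S (\<lambda>x. \<bar>linear_det (g' x)\<bar> * F (g x))"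
    unfolding set_integrable_def lebesgue_coords(1)[of ?L, symmetric] lebesgue_coords(1)[of ?R, symmetric]
    by (simp add: G_def G'_def linear_det_def comp_def)
  have "integral\<^sup>L lebesgue ?L = integral\<^sup>L lebesgue ?R"
    using change_of_variables_coords(2)[OF S' _ inj', of G' "F \<circ> of_coords"] der'
    unfolding set_lebesgue_integral_def img by blast
  then show "(LINT x:g ` S|lebesgue. F x) = (LINT x:S|lebesgue. \<bar>linear_det (g' x)\<bar> * F (g x))"
    unfolding set_lebesgue_integral_def
      lebesgue_coords(2)[of ?L, symmetric] lebesgue_coords(2)[of ?R, symmetric]
    by (simp add: G_def G'_def linear_det_def comp_def)
qed

section \<open>Function spaces and test functions\<close>

lemma Lp_iff_lebesgue_on:
  assumes "S \<in> sets lebesgue"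
  shows "f \<in> Lp p S \<longleftrightarrow> f \<in> borel_measurable (lebesgue_on S) \<and>
    integrable (lebesgue_on S) (\<lambda>x. norm (f x) powr p)"
  using assms by (simp add: Lp_def set_integrable_def integrable_restrict_space)

lemma Lp_loc_subset: "f \<in> Lp_loc p \<Omega> \<Longrightarrow> \<Omega>' \<subseteq> \<Omega> \<Longrightarrow> f \<in> Lp_loc p \<Omega>'"
  unfolding Lp_loc_def by blast

lemma powr_add_le:
  fixes a b p :: real
  assumes "a \<ge> 0" "b \<ge> 0" "p > 0"
  shows "(a + b) powr p \<le> 2 powr p * (a powr p + b powr p)"
proof -
  have "(a + b) powr p \<le> (2 * max a b) powr p"
    using assms by (intro powr_mono2) auto
  also have "\<dots> = 2 powr p * max a b powr p"
    using assms by (simp add: powr_mult)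
  also have "\<dots> \<le> 2 powr p * (a powr p + b powr p)"
    by (intro mult_left_mono) (auto simp: max_def)
  finally show ?thesis .
qed

lemma Lp_dominated:
  assumes S: "S \<in> sets lebesgue" and p: "p > 0" and w: "w \<in> borel_measurable (lebesgue_on S)"
    and F: "F \<in> Lp p S" and G: "G \<in> Lp p S"
    and le: "\<And>y. y \<in> S \<Longrightarrow> norm (w y) \<le> C * (norm (F y) + norm (G y))"
  shows "w \<in> Lp p S"
proof -
  let ?b = "\<lambda>x. \<bar>C\<bar> powr p * (2 powr p * (norm (F x) powr p + norm (G x) powr p))"
  have "integrable (lebesgue_on S) ?b"
    using F G S by (auto simp: Lp_iff_lebesgue_on)
  then have "integrable (lebesgue_on S) (\<lambda>x. norm (w x) powr p)"
  proof (rule Bochner_Integration.integrable_bound)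
    show "(\<lambda>x. norm (w x) powr p) \<in> borel_measurable (lebesgue_on S)"
      using w by measurable
    show "AE x in lebesgue_on S. norm (norm (w x) powr p) \<le> norm (?b x)"
    proof (rule AE_I2)
      fix x assume "x \<in> space (lebesgue_on S)"
      then have "norm (w x) \<le> C * (norm (F x) + norm (G x))"
        using le S by simp
      also have "\<dots> \<le> \<bar>C\<bar> * (norm (F x) + norm (G x))"
        by (intro mult_right_mono) auto
      finally have "norm (w x) powr p \<le> (\<bar>C\<bar> * (norm (F x) + norm (G x))) powr p"
        using p by (intro powr_mono2) auto
      also have "\<dots> = \<bar>C\<bar> powr p * (norm (F x) + norm (G x)) powr p"
        by (simp add: powr_mult)
      also have "\<dots> \<le> ?b x"
        using p by (intro mult_left_mono powr_add_le) auto
      finally show "norm (norm (w x) powr p) \<le> norm (?b x)"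
        by simp
    qed
  qed
  then show ?thesis
    using w S by (simp add: Lp_iff_lebesgue_on)
qed

text \<open>The factor \<open>c\<close> is bounded on each compact subset of
  \<open>\<Omega>\<close>, so it may blow up at the boundary, in particular at the origin of the
  punctured space.\<close>

lemma Lp_loc_dominated:
  fixes w :: "'a::euclidean_space \<Rightarrow> 'b::euclidean_space"
  assumes p: "p > 0"
    and w: "\<And>S. compact S \<Longrightarrow> S \<subseteq> \<Omega> \<Longrightarrow> w \<in> borel_measurable (lebesgue_on S)"
    and F: "F \<in> Lp_loc p \<Omega>" and G: "G \<in> Lp_loc p \<Omega>"
    and c: "continuous_on \<Omega> c"
    and le: "\<And>y. y \<in> \<Omega> \<Longrightarrow> norm (w y) \<le> c y * (norm (F y) + norm (G y))"
  shows "w \<in> Lp_loc p \<Omega>"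
  unfolding Lp_loc_def
proof (intro CollectI allI impI, elim conjE)
  fix S assume S: "compact S" "S \<subseteq> \<Omega>"
  then have "compact (c ` S)"
    using c compact_continuous_image continuous_on_subset by blast
  then obtain C where C: "\<And>y. y \<in> S \<Longrightarrow> norm (c y) \<le> C"
    by (meson bounded_iff compact_imp_bounded imageI)
  have "norm (w y) \<le> C * (norm (F y) + norm (G y))" if "y \<in> S" for y
    using le[of y] C[OF that] that S(2)
    by (smt (verit) mult_right_mono norm_ge_zero real_norm_def subsetD)
  moreover have "F \<in> Lp p S" "G \<in> Lp p S"
    using F G S unfolding Lp_loc_def by blast+
  moreover have "S \<in> sets lebesgue"
    using lmeasurable_compact[OF S(1)] by (rule fmeasurableD)
  ultimately show "w \<in> Lp p S"
    using Lp_dominated p w[OF S] by metis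
qed

section \<open>Gradients and compactly supported C^1 functions\<close>

lemma gderiv_gradient:
  fixes f :: "'a::euclidean_space \<Rightarrow> real"
  assumes "f differentiable (at x)"
  shows "GDERIV f x :> gradient f x"
proof -
  obtain L where L: "(f has_derivative L) (at x)"
    using assms by (auto simp: differentiable_def)
  interpret bounded_linear L
    using L by (rule has_derivative_bounded_linear)
  define D where "D = (\<Sum>b\<in>Basis. L b *\<^sub>R b)"
  have "L h = h \<bullet> D" for h
  proof -
    have "L h = L (\<Sum>b\<in>Basis. (h \<bullet> b) *\<^sub>R b)"
      by (simp add: euclidean_representation)
    also have "\<dots> = h \<bullet> D"
      by (simp add: sum scaleR D_def inner_sum_right mult.commute)
    finally show ?thesis .
  qed
  then have "L = (\<lambda>h. h \<bullet> D)"
    by (rule ext)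
  then have "GDERIV f x :> D"
    using L by (simp add: gderiv_def)
  then show ?thesis
    using gradient_eqI by blast
qed

lemma gderiv_zero_outside_closed:
  fixes f :: "'a::euclidean_space \<Rightarrow> real"
  assumes K: "closed K" and "\<And>y. y \<notin> K \<Longrightarrow> f y = 0" and "x \<notin> K"
  shows "GDERIV f x :> 0"
proof -
  have "(f has_derivative (\<lambda>h. 0)) (at x)"
    by (rule has_derivative_transform_within_open[of "\<lambda>x. 0" _ _ _ "- K"]) (use assms in auto)
  then show ?thesis
    by (simp add: gderiv_def)
qed

lemma C1_c_gderiv: "\<phi> \<in> C1_c \<Omega> \<Longrightarrow> GDERIV \<phi> x :> gradient \<phi> x"
  by (rule gderiv_gradient) (simp add: C1_c_def)

lemma C1_c_continuous: "\<phi> \<in> C1_c \<Omega> \<Longrightarrow> continuous_on UNIV \<phi>"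
  by (auto simp: C1_c_def intro!: continuous_at_imp_continuous_on differentiable_imp_continuous_within)

lemma C1_c_continuous_gradient: "\<phi> \<in> C1_c \<Omega> \<Longrightarrow> continuous_on UNIV (gradient \<phi>)"
  by (simp add: C1_c_def)

lemma C1_c_mono: "\<phi> \<in> C1_c \<Omega> \<Longrightarrow> \<Omega> \<subseteq> \<Omega>' \<Longrightarrow> \<phi> \<in> C1_c \<Omega>'"
  by (auto simp: C1_c_def)

lemma C1_c_support:
  assumes "\<phi> \<in> C1_c \<Omega>"
  obtains K where "compact K" "K \<subseteq> \<Omega>" "\<forall>x. x \<notin> K \<longrightarrow> \<phi> x = 0 \<and> gradient \<phi> x = 0"
proof
  let ?K = "closure {x. \<phi> x \<noteq> 0}"
  show "compact ?K" "?K \<subseteq> \<Omega>"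
    using assms by (auto simp: C1_c_def)
  have 0: "\<phi> x = 0" if "x \<notin> ?K" for x
    using closure_subset[of "{x. \<phi> x \<noteq> 0}"] that by auto
  have "gradient \<phi> x = 0" if "x \<notin> ?K" for x
    by (rule gradient_eqI, rule gderiv_zero_outside_closed[OF closed_closure 0 that])
  with 0 show "\<forall>x. x \<notin> ?K \<longrightarrow> \<phi> x = 0 \<and> gradient \<phi> x = 0"
    by blast
qed

text \<open>The formula for the gradient is known on \<open>\<Omega>\<close> only. Off
  \<open>K\<close> the gradient is 0, and the two open sets \<open>\<Omega>\<close> and
  \<open>- K\<close> cover the space, so the continuous pieces glue. This admits functions given by
  expressions that are singular outside \<open>\<Omega>\<close>.\<close>

lemma C1_cI:
  fixes \<psi> :: "'a::euclidean_space \<Rightarrow> real"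
  assumes \<Omega>: "open \<Omega>" and K: "compact K" "K \<subseteq> \<Omega>" and zero: "\<And>x. x \<notin> K \<Longrightarrow> \<psi> x = 0"
    and D: "\<And>x. x \<in> \<Omega> \<Longrightarrow> GDERIV \<psi> x :> D x" and cont: "continuous_on \<Omega> D"
  shows "\<psi> \<in> C1_c \<Omega>"
proof -
  have cl: "closed K"
    using K compact_imp_closed by blast
  have out: "GDERIV \<psi> x :> 0" if "x \<notin> K" for x
    using gderiv_zero_outside_closed[OF cl zero that] .
  have "\<psi> differentiable (at x)" for x
    using D[of x] out[of x] K(2) by (auto simp: gderiv_def differentiable_def)
  moreover have "continuous_on (\<Omega> \<union> - K) (gradient \<psi>)"
  proof (rule continuous_on_open_Un)
    show "continuous_on \<Omega> (gradient \<psi>)"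
      by (rule continuous_on_eq[OF cont]) (simp add: gradient_eqI[OF D])
    show "continuous_on (- K) (gradient \<psi>)"
      by (rule continuous_on_eq[OF continuous_on_const[of _ 0]]) (simp add: gradient_eqI[OF out])
  qed (use cl \<Omega> in auto)
  moreover have "\<Omega> \<union> - K = UNIV"
    using K by auto
  moreover have "closure {x. \<psi> x \<noteq> 0} \<subseteq> K"
    using zero cl by (intro closure_minimal) auto
  moreover from this have "compact (closure {x. \<psi> x \<noteq> 0})"
    using K(1) by (metis closed_closure compact_Int_closed inf.absorb_iff2)
  ultimately show ?thesis
    using K(2) by (auto simp: C1_c_def)
qed

lemma C1_c_mult:
  fixes \<psi> a :: "'a::euclidean_space \<Rightarrow> real"
  assumes \<Omega>: "open \<Omega>" and \<psi>: "\<psi> \<in> C1_c \<Omega>"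
    and a: "\<And>x. x \<in> \<Omega> \<Longrightarrow> GDERIV a x :> a' x" "continuous_on \<Omega> a'"
  shows "(\<lambda>x. a x * \<psi> x) \<in> C1_c \<Omega>"
    and "x \<in> \<Omega> \<Longrightarrow> gradient (\<lambda>x. a x * \<psi> x) x = a x *\<^sub>R gradient \<psi> x + \<psi> x *\<^sub>R a' x"
proof -
  obtain K where K: "compact K" "K \<subseteq> \<Omega>" "\<forall>x. x \<notin> K \<longrightarrow> \<psi> x = 0 \<and> gradient \<psi> x = 0"
    by (rule C1_c_support[OF \<psi>])
  have D: "GDERIV (\<lambda>x. a x * \<psi> x) x :> a x *\<^sub>R gradient \<psi> x + \<psi> x *\<^sub>R a' x" if "x \<in> \<Omega>" for x
    by (intro GDERIV_mult a that C1_c_gderiv[OF \<psi>])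
  have "continuous_on \<Omega> a"
    using a(1) by (intro continuous_at_imp_continuous_on)
      (auto simp: gderiv_def intro: has_derivative_continuous)
  then have "continuous_on \<Omega> (\<lambda>x. a x *\<^sub>R gradient \<psi> x + \<psi> x *\<^sub>R a' x)"
    using a(2) C1_c_continuous[OF \<psi>] C1_c_continuous_gradient[OF \<psi>]
    by (intro continuous_intros) (auto intro: continuous_on_subset)
  then show "(\<lambda>x. a x * \<psi> x) \<in> C1_c \<Omega>"
    by (intro C1_cI[OF \<Omega> K(1,2) _ D]) (auto simp: K(3))
  show "x \<in> \<Omega> \<Longrightarrow> gradient (\<lambda>x. a x * \<psi> x) x = a x *\<^sub>R gradient \<psi> x + \<psi> x *\<^sub>R a' x"
    using D gradient_eqI by blast
qed

text \<open>The integrands to be split later are products of a continuous factor of compact support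
  and a locally integrable one. A general bilinear product covers scalar multiples, in either order,
  and inner products at once.\<close>

lemma Lp_loc_integrable_bilinear:
  fixes F :: "'a::euclidean_space \<Rightarrow> 'b::euclidean_space"
    and w :: "'a \<Rightarrow> 'c::euclidean_space" and prod :: "'c \<Rightarrow> 'b \<Rightarrow> 'd::euclidean_space"
  assumes prod: "bounded_bilinear prod" and F: "F \<in> Lp_loc 1 \<Omega>"
    and w: "continuous_on UNIV w" and K: "compact K" "K \<subseteq> \<Omega>" "\<And>x. x \<notin> K \<Longrightarrow> w x = 0"
  shows "integrable lebesgue (\<lambda>x. prod (w x) (F x))"
proof -
  interpret bounded_bilinear prod by fact
  from nonneg_bounded obtain B where B: "0 \<le> B" "\<And>a b. norm (prod a b) \<le> norm a * norm b * B"
    by auto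
  have "compact (w ` K)"
    using w K compact_continuous_image continuous_on_subset by blast
  then obtain C where C: "\<And>y. y \<in> K \<Longrightarrow> norm (w y) \<le> C"
    by (meson bounded_iff compact_imp_bounded imageI)
  have meas: "K \<in> sets lebesgue"
    using lmeasurable_compact[OF K(1)] by (auto simp: fmeasurableD)
  have F': "F \<in> borel_measurable (lebesgue_on K)" "integrable (lebesgue_on K) (\<lambda>x. norm (F x))"
    using F K meas by (auto simp: Lp_loc_def Lp_iff_lebesgue_on)
  have "integrable (lebesgue_on K) (\<lambda>x. prod (w x) (F x))"
  proof (rule Bochner_Integration.integrable_bound)
    show "integrable (lebesgue_on K) (\<lambda>x. C * B * norm (F x))"
      using F' by simp
    have "w \<in> borel_measurable (lebesgue_on K)"
      using w meas continuous_imp_measurable_on_sets_lebesgue continuous_on_subset by blast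
    then show "(\<lambda>x. prod (w x) (F x)) \<in> borel_measurable (lebesgue_on K)"
      using F'(1) by (rule borel_measurable_continuous_Pair)
        (intro continuous_on continuous_on_fst continuous_on_snd continuous_on_id)
    show "AE x in lebesgue_on K. norm (prod (w x) (F x)) \<le> norm (C * B * norm (F x))"
    proof (rule AE_I2)
      fix x assume "x \<in> space (lebesgue_on K)"
      then have "norm (w x) \<le> C"
        using C meas by simp
      then have "norm (w x) * norm (F x) * B \<le> C * norm (F x) * B"
        using B(1) by (intro mult_right_mono) auto
      also have "\<dots> \<le> norm (C * B * norm (F x))"
        by (simp add: mult_ac)
      finally show "norm (prod (w x) (F x)) \<le> norm (C * B * norm (F x))"
        using B(2) order_trans by blast
    qed
  qed
  then have "integrable lebesgue (\<lambda>x. indicator K x *\<^sub>R prod (w x) (F x))"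
    using meas by (simp add: integrable_restrict_space)
  moreover have "indicator K x *\<^sub>R prod (w x) (F x) = prod (w x) (F x)" for x
    using K(3) zero_left by (auto simp: indicator_def)
  ultimately show ?thesis
    by simp
qed

lemma C1_c_integrable:
  fixes F :: "'a::euclidean_space \<Rightarrow> 'b::euclidean_space"
  assumes F: "F \<in> Lp_loc 1 \<Omega>" and \<phi>: "\<phi> \<in> C1_c \<Omega>"
  shows "integrable lebesgue (\<lambda>x. \<phi> x *\<^sub>R F x)"
proof -
  obtain K where "compact K" "K \<subseteq> \<Omega>" "\<forall>x. x \<notin> K \<longrightarrow> \<phi> x = 0 \<and> gradient \<phi> x = 0"
    by (rule C1_c_support[OF \<phi>])
  with F C1_c_continuous[OF \<phi>] show ?thesis
    by (intro Lp_loc_integrable_bilinear[OF bounded_bilinear_scaleR]) auto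
qed

lemma C1_c_integrable_gradient:
  fixes F :: "'a::euclidean_space \<Rightarrow> 'b::euclidean_space" and prod :: "'a \<Rightarrow> 'b \<Rightarrow> 'd::euclidean_space"
  assumes prod: "bounded_bilinear prod" and F: "F \<in> Lp_loc 1 \<Omega>" and \<phi>: "\<phi> \<in> C1_c \<Omega>"
  shows "integrable lebesgue (\<lambda>x. prod (gradient \<phi> x) (F x))"
proof -
  obtain K where "compact K" "K \<subseteq> \<Omega>" "\<forall>x. x \<notin> K \<longrightarrow> \<phi> x = 0 \<and> gradient \<phi> x = 0"
    by (rule C1_c_support[OF \<phi>])
  with F C1_c_continuous_gradient[OF \<phi>] show ?thesis
    by (intro Lp_loc_integrable_bilinear[OF prod]) auto
qed

section \<open>Weak gradients as scalar identities over the whole space\<close>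

lemma set_lebesgue_integral_supported:
  assumes "\<And>x. x \<notin> \<Omega> \<Longrightarrow> F x = 0"
  shows "(LINT x:\<Omega>|M. F x) = integral\<^sup>L M F"
  unfolding set_lebesgue_integral_def
  by (rule Bochner_Integration.integral_cong) (use assms in \<open>auto simp: indicator_def\<close>)

lemma C1_c_zero: "\<phi> \<in> C1_c \<Omega> \<Longrightarrow> x \<notin> \<Omega> \<Longrightarrow> \<phi> x = 0"
  "\<phi> \<in> C1_c \<Omega> \<Longrightarrow> x \<notin> \<Omega> \<Longrightarrow> gradient \<phi> x = 0"
  using C1_c_support[of \<phi> \<Omega> "\<phi> x = 0 \<and> gradient \<phi> x = 0"] by blast+

text \<open>Pairing the vector identity with a fixed \<open>e\<close> makes it accessible to the
  change of variables for real functions. The inner product may be moved under the integral because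
  local integrability of \<open>v\<close> and \<open>g\<close> makes both vector integrals
  converge.\<close>

lemma has_weak_gradient_iff:
  fixes v :: "'a::euclidean_space \<Rightarrow> real"
  shows "has_weak_gradient \<Omega> v g \<longleftrightarrow> v \<in> Lp_loc 1 \<Omega> \<and> g \<in> Lp_loc 1 \<Omega> \<and>
     (\<forall>\<phi>\<in>C1_c \<Omega>. \<forall>e. (\<integral>x. v x * (gradient \<phi> x \<bullet> e) \<partial>lebesgue) = - (\<integral>x. \<phi> x * (g x \<bullet> e) \<partial>lebesgue))"
proof -
  have "(LINT x:\<Omega>|lebesgue. v x *\<^sub>R gradient \<phi> x) = - (LINT x:\<Omega>|lebesgue. \<phi> x *\<^sub>R g x) \<longleftrightarrow>
      (\<forall>e. (\<integral>x. v x * (gradient \<phi> x \<bullet> e) \<partial>lebesgue) = - (\<integral>x. \<phi> x * (g x \<bullet> e) \<partial>lebesgue))"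
    if v: "v \<in> Lp_loc 1 \<Omega>" and g: "g \<in> Lp_loc 1 \<Omega>" and \<phi>: "\<phi> \<in> C1_c \<Omega>" for \<phi>
  proof -
    have 1: "integrable lebesgue (\<lambda>x. v x *\<^sub>R gradient \<phi> x)"
      using C1_c_integrable_gradient[OF bounded_bilinear.flip[OF bounded_bilinear_scaleR] v \<phi>] .
    have 2: "integrable lebesgue (\<lambda>x. \<phi> x *\<^sub>R g x)"
      using C1_c_integrable[OF g \<phi>] .
    have 3: "(LINT x:\<Omega>|lebesgue. v x *\<^sub>R gradient \<phi> x) = (\<integral>x. v x *\<^sub>R gradient \<phi> x \<partial>lebesgue)"
      by (rule set_lebesgue_integral_supported) (simp add: C1_c_zero[OF \<phi>])
    have 4: "(LINT x:\<Omega>|lebesgue. \<phi> x *\<^sub>R g x) = (\<integral>x. \<phi> x *\<^sub>R g x \<partial>lebesgue)"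
      by (rule set_lebesgue_integral_supported) (simp add: C1_c_zero[OF \<phi>])
    have 5: "(\<integral>x. v x *\<^sub>R gradient \<phi> x \<partial>lebesgue) \<bullet> e = (\<integral>x. v x * (gradient \<phi> x \<bullet> e) \<partial>lebesgue)" for e
      using integral_inner_left[OF 1, of e] by simp
    have 6: "(\<integral>x. \<phi> x *\<^sub>R g x \<partial>lebesgue) \<bullet> e = (\<integral>x. \<phi> x * (g x \<bullet> e) \<partial>lebesgue)" for e
      using integral_inner_left[OF 2, of e] by simp
    show ?thesis
      using vector_eq_rdot[of "\<integral>x. v x *\<^sub>R gradient \<phi> x \<partial>lebesgue" "- (\<integral>x. \<phi> x *\<^sub>R g x \<partial>lebesgue)"]
      unfolding 3 4 inner_minus_left 5 6 by blast
  qed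
  then show ?thesis
    unfolding has_weak_gradient_def by blast
qed

lemma has_weak_gradient_subset:
  "has_weak_gradient \<Omega> v g \<Longrightarrow> \<Omega>' \<subseteq> \<Omega> \<Longrightarrow> has_weak_gradient \<Omega>' v g"
  unfolding has_weak_gradient_iff by (simp add: Lp_loc_subset[of _ _ \<Omega> \<Omega>'] C1_c_mono[of _ \<Omega>' \<Omega>])

section \<open>The anisotropic inversion\<close>

definition energy_norm :: "('a::euclidean_space \<Rightarrow> 'a) \<Rightarrow> 'a \<Rightarrow> real" where
  "energy_norm A x = sqrt (A x \<bullet> x)"

text \<open>At the origin the value is 0 because \<open>inverse 0 = 0\<close>. This makes
  \<open>inversion_inverse\<close> and \<open>energy_norm_inversion\<close> hold without excluding
  the origin.\<close>

definition inversion :: "('a::euclidean_space \<Rightarrow> 'a) \<Rightarrow> 'a \<Rightarrow> 'a" where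
  "inversion A x = A x /\<^sub>R (A x \<bullet> x)"

text \<open>The matrix \<open>M\<close> and its inverse enter symmetrically as \<open>A\<close> and \<open>B\<close>, so that every fact below
  is also available with the two exchanged, under the prefix \<open>dual\<close>.\<close>

locale dual_forms =
  fixes A B :: "'a::euclidean_space \<Rightarrow> 'a"
  assumes linear_A: "linear A"
    and A_sym: "A x \<bullet> y = x \<bullet> A y"
    and A_pos: "x \<noteq> 0 \<Longrightarrow> A x \<bullet> x > 0"
    and A_B [simp]: "A (B x) = x"
    and B_A [simp]: "B (A x) = x"
begin

lemma dual_forms_swap: "dual_forms B A"
proof (rule dual_forms.intro)
  have inj: "x = y" if "A x = A y" for x y
    using that by (metis B_A)
  show "linear B"
    by (rule linearI; rule inj) (simp_all add: linear_add[OF linear_A] linear_cmul[OF linear_A])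
  show "B x \<bullet> y = x \<bullet> B y" for x y
    using A_sym[of "B x" "B y"] by simp
  show "B x \<bullet> x > 0" if "x \<noteq> 0" for x
  proof -
    have "B x \<noteq> 0"
      using that linear_0[OF linear_A] by (metis A_B)
    from A_pos[OF this] show ?thesis
      by (simp add: inner_commute)
  qed
qed simp_all

end

sublocale dual_forms \<subseteq> dual: dual_forms B A
  by (rule dual_forms_swap)

context dual_forms
begin

lemmas linear_B = dual.linear_A
lemmas A_simps [simp] = linear_0[OF linear_A] linear_add[OF linear_A] linear_diff[OF linear_A]
  linear_cmul[OF linear_A]
lemmas B_simps [simp] = linear_0[OF linear_B] linear_add[OF linear_B] linear_diff[OF linear_B]
  linear_cmul[OF linear_B]

lemma bounded_linear_A: "bounded_linear A"
  using linear_A linear_conv_bounded_linear by blast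

abbreviation H where "H \<equiv> energy_norm A"
abbreviation q where "q \<equiv> energy_norm B"
abbreviation T where "T \<equiv> inversion A"
abbreviation S where "S \<equiv> inversion B"

lemma energy_norm_power2: "(H x)\<^sup>2 = A x \<bullet> x"
  using A_pos[of x] by (cases "x = 0") (simp_all add: energy_norm_def)

lemma energy_norm_pos: "x \<noteq> 0 \<Longrightarrow> H x > 0"
  using A_pos[of x] by (simp add: energy_norm_def)

lemma inversion_eq: "T x = A x /\<^sub>R (H x)\<^sup>2"
  by (simp add: inversion_def energy_norm_power2)

lemma B_inner_A: "B x \<bullet> A y = x \<bullet> y"
  by (metis A_sym A_B)

lemma A_inner_B: "A x \<bullet> B y = x \<bullet> y"
  by (metis A_sym A_B)

lemma B_inversion_inner:
  assumes "x \<noteq> 0"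
  shows "B (T x) \<bullet> T x = inverse ((H x)\<^sup>2)"
proof -
  have "x \<bullet> A x = (H x)\<^sup>2"
    by (simp add: energy_norm_power2 inner_commute)
  then show ?thesis
    using energy_norm_pos[OF assms] by (simp add: inversion_eq)
qed

lemma inversion_inverse [simp]: "S (T x) = x"
proof (cases "x = 0")
  case False
  have "B (T x) = x /\<^sub>R (H x)\<^sup>2"
    by (simp add: inversion_eq)
  then show ?thesis
    unfolding inversion_def[of B "T x"] B_inversion_inner[OF False]
    using energy_norm_pos[OF False] by simp
qed (simp add: inversion_def)

lemma inversion_eq_0_iff [simp]: "T x = 0 \<longleftrightarrow> x = 0"
proof
  assume "T x = 0"
  then have "S (T x) = 0"
    by (simp add: inversion_def[of B])
  then show "x = 0"
    by simp
qed (simp add: inversion_def)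

lemma energy_norm_inversion: "q (T x) = 1 / H x"
proof (cases "x = 0")
  case False
  then show ?thesis
    using energy_norm_pos[OF False]
    by (simp add: energy_norm_def[of B] B_inversion_inner[OF False] real_sqrt_inverse divide_inverse)
qed (simp add: energy_norm_def inversion_def)

lemma quad_has_derivative: "((\<lambda>x. A x \<bullet> x) has_derivative (\<lambda>h. 2 * (A x \<bullet> h))) (at x within X)"
proof -
  have "((\<lambda>x. A x \<bullet> x) has_derivative (\<lambda>h. A x \<bullet> h + A h \<bullet> x)) (at x within X)"
    by (intro has_derivative_inner bounded_linear_imp_has_derivative bounded_linear_A has_derivative_ident)
  moreover have "A x \<bullet> h + A h \<bullet> x = 2 * (A x \<bullet> h)" for h
    by (simp add: A_sym[of h] inner_commute[of h])
  ultimately show ?thesis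
    by simp
qed

lemma energy_norm_gderiv:
  assumes "x \<noteq> 0"
  shows "GDERIV H x :> A x /\<^sub>R H x"
proof -
  have "((\<lambda>x. sqrt (A x \<bullet> x)) has_derivative (\<lambda>h. 2 * (A x \<bullet> h) * (inverse (sqrt (A x \<bullet> x)) / 2))) (at x)"
    using has_derivative_real_sqrt[OF A_pos[OF assms] quad_has_derivative] by simp
  moreover have "(\<lambda>x. sqrt (A x \<bullet> x)) = H"
    by (simp add: fun_eq_iff energy_norm_def)
  ultimately show ?thesis
    by (simp add: gderiv_def energy_norm_def inner_commute mult_ac)
qed

lemma continuous_on_energy_norm: "continuous_on X H"
  unfolding energy_norm_def
  by (intro continuous_intros linear_continuous_on bounded_linear_A)

lemma inverse_power_gderiv:
  assumes "x \<noteq> 0"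
  shows "GDERIV (\<lambda>x. 1 / H x ^ k) x :> (- real k / H x ^ (k + 2)) *\<^sub>R A x"
proof -
  have "((\<lambda>t. 1 / t ^ k) has_field_derivative (- real k / H x ^ (k + 1))) (at (H x))"
  \<comment> \<open>The exponent 0 does occur, as \<open>m\<close> in dimension two; the function is
    then constant.\<close>
  proof (cases k)
    case (Suc n)
    have "((\<lambda>t. inverse (t ^ k)) has_field_derivative
        - (inverse (H x ^ k) * (real k * H x ^ (k - Suc 0)) * inverse (H x ^ k))) (at (H x))"
      using energy_norm_pos[OF assms] DERIV_inverse'[OF DERIV_pow[of k "H x" UNIV]] by simp
    moreover have "inverse (H x ^ k) * (real k * H x ^ (k - Suc 0)) * inverse (H x ^ k) = real k / H x ^ (k + 1)"
      using energy_norm_pos[OF assms] by (simp add: Suc divide_inverse)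
    ultimately show ?thesis
      by (simp add: divide_inverse)
  qed simp
  from GDERIV_DERIV_compose[OF energy_norm_gderiv[OF assms] this] show ?thesis
    by (rule GDERIV_subst) (use energy_norm_pos[OF assms] in \<open>simp add: field_simps power2_eq_square\<close>)
qed

lemma finsler_field_energy_norm: "finsler_field H \<eta> = A \<eta>"
proof (cases "\<eta> = 0")
  case False
  then show ?thesis
    using gradient_eqI[OF energy_norm_gderiv[OF False]] energy_norm_pos[OF False]
    by (simp add: finsler_field_def)
qed (simp add: finsler_field_def)

lemma T_map_energy_norm: "T_map H y = T y"
proof (cases "y = 0")
  case True
  \<comment> \<open>Both sides are junk values at the origin; they agree because \<open>inverse 0 = 0\<close>.\<close>
  then show ?thesis
    by (simp add: T_map_def inversion_def energy_norm_def)
next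
  case False
  then show ?thesis
    using gradient_eqI[OF energy_norm_gderiv[of y]] energy_norm_pos[of y]
    by (simp add: T_map_def inversion_eq power2_eq_square)
qed

end

section \<open>The dual norm; derivative and Jacobian of the inversion\<close>

context dual_forms
begin

text \<open>This is the Cauchy-Schwarz inequality of the inner product defined by \<open>A\<close>,
  applied to \<open>\<xi>\<close> and \<open>B x\<close>: their product is
  \<open>\<xi> \<bullet> x\<close>, and \<open>H (B x)\<close> equals \<open>q x\<close>.\<close>

lemma Cauchy_Schwarz: "\<bar>\<xi> \<bullet> x\<bar> \<le> H \<xi> * q x"
proof (cases "x = 0")
  case False
  \<comment> \<open>The minimiser over \<open>t\<close> of the square of
    \<open>H (\<xi> - t *\<^sub>R B x)\<close>.\<close>
  define t where "t = (\<xi> \<bullet> x) / (q x)\<^sup>2"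
  have q: "q x > 0"
    using dual.energy_norm_pos[OF False] .
  have "0 \<le> (H (\<xi> - t *\<^sub>R B x))\<^sup>2"
    by simp
  also have "\<dots> = (H \<xi>)\<^sup>2 - 2 * t * (\<xi> \<bullet> x) + t\<^sup>2 * (q x)\<^sup>2"
    unfolding energy_norm_power2 dual.energy_norm_power2
    by (simp add: inner_diff_left inner_diff_right A_inner_B inner_commute[of x] power2_eq_square
        algebra_simps)
  also have "\<dots> = (H \<xi>)\<^sup>2 - (\<xi> \<bullet> x)\<^sup>2 / (q x)\<^sup>2"
    using q by (simp add: t_def field_simps power2_eq_square)
  finally have "(\<xi> \<bullet> x)\<^sup>2 \<le> (H \<xi> * q x)\<^sup>2"
    using q by (simp add: field_simps power_mult_distrib)
  moreover have "0 \<le> H \<xi> * q x"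
    using q energy_norm_pos[of \<xi>] by (cases "\<xi> = 0") (auto simp: energy_norm_def)
  ultimately show ?thesis
    by (metis abs_le_square_iff abs_of_nonneg)
qed (simp add: energy_norm_def)

text \<open>The supremum is attained: for nonzero \<open>x\<close> the vector
  \<open>B x /\<^sub>R q x\<close> lies on the unit sphere of \<open>H\<close> and is the equality
  case of \<open>Cauchy_Schwarz\<close>.\<close>

lemma dual_norm_energy_norm: "dual_norm H = q"
proof
  fix x
  have H0: "H 0 = 0"
    by (simp add: energy_norm_def)
  have q0: "q x \<ge> 0"
    using dual.energy_norm_pos[of x] by (cases "x = 0") (auto simp: energy_norm_def)
  have "(SUP \<xi>\<in>{\<xi>. H \<xi> \<le> 1}. \<xi> \<bullet> x) = q x"
  proof (rule cSup_eq_maximum)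
    show "q x \<in> (\<lambda>\<xi>. \<xi> \<bullet> x) ` {\<xi>. H \<xi> \<le> 1}"
    proof (cases "x = 0")
      case True
      then show ?thesis
        using H0 by (auto simp: energy_norm_def intro!: image_eqI[of _ _ 0])
    next
      case False
      have q: "q x > 0"
        using dual.energy_norm_pos[OF False] .
      have "(B x /\<^sub>R q x) \<bullet> x = q x"
        using q by (simp add: dual.energy_norm_power2[symmetric] power2_eq_square)
      moreover have "(H (B x /\<^sub>R q x))\<^sup>2 = 1"
        unfolding energy_norm_power2
        using q by (simp add: inner_commute[of x] dual.energy_norm_power2[symmetric] power2_eq_square
            field_simps)
      then have "H (B x /\<^sub>R q x) \<le> 1"
        by (auto simp: power2_eq_1_iff)
      ultimately show ?thesis
        by (intro image_eqI[of _ _ "B x /\<^sub>R q x"]) auto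
    qed
  next
    fix y assume "y \<in> (\<lambda>\<xi>. \<xi> \<bullet> x) ` {\<xi>. H \<xi> \<le> 1}"
    then obtain \<xi> where "y = \<xi> \<bullet> x" "H \<xi> \<le> 1"
      by auto
    then show "y \<le> q x"
      using Cauchy_Schwarz[of \<xi> x] q0 mult_right_mono[of "H \<xi>" 1 "q x"] by auto
  qed
  then show "dual_norm H x = q x"
    by (simp add: dual_norm_def)
qed

text \<open>This is \<open>A\<close> divided by the square of \<open>H x\<close>, composed with the
  reflection \<open>h - 2 (A x \<bullet> h) / (H x)^2 x\<close>, which sends \<open>x\<close> to
  \<open>- x\<close> and fixes the vectors orthogonal to \<open>x\<close> with respect to
  \<open>A\<close>.\<close>

definition DT :: "'a \<Rightarrow> 'a \<Rightarrow> 'a" where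
  "DT x h = A h /\<^sub>R (H x)\<^sup>2 - (2 * (A x \<bullet> h) / H x ^ 4) *\<^sub>R A x"

lemma inversion_has_derivative:
  assumes "x \<noteq> 0"
  shows "(T has_derivative DT x) (at x within X)"
proof -
  have nz: "A x \<bullet> x \<noteq> 0"
    using A_pos[OF assms] by simp
  have "((\<lambda>x. inverse (A x \<bullet> x) *\<^sub>R A x) has_derivative
      (\<lambda>h. inverse (A x \<bullet> x) *\<^sub>R A h + (- (inverse (A x \<bullet> x) * (2 * (A x \<bullet> h)) * inverse (A x \<bullet> x))) *\<^sub>R A x)) (at x within X)"
    by (intro has_derivative_scaleR Deriv.has_derivative_inverse[OF nz quad_has_derivative]
        bounded_linear_imp_has_derivative bounded_linear_A)
  moreover have "inverse (A x \<bullet> x) *\<^sub>R A h + (- (inverse (A x \<bullet> x) * (2 * (A x \<bullet> h)) * inverse (A x \<bullet> x))) *\<^sub>R A x = DT x h" for h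
    using energy_norm_pos[OF assms]
    by (simp add: DT_def energy_norm_power2[symmetric] field_simps power2_eq_square power4_eq_xxxx)
  moreover have "(\<lambda>x. inverse (A x \<bullet> x) *\<^sub>R A x) = T"
    by (simp add: fun_eq_iff inversion_def)
  ultimately show ?thesis
    by simp
qed

lemma linear_DT: "linear (DT x)"
  by (rule linearI) (simp_all add: DT_def inner_add_right algebra_simps add_divide_distrib)

lemma DT_sym: "DT x h \<bullet> k = h \<bullet> DT x k"
  by (simp add: DT_def inner_diff_left inner_diff_right A_sym[of h k] inner_commute[of h "A x"] mult_ac)

text \<open>In terms of the reflection in \<open>DT\<close>, the inner \<open>B\<close> cancels one
  factor \<open>A\<close>, and the two reflections compose to the identity.\<close>

lemma DT_conformal:
  assumes "x \<noteq> 0"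
  shows "DT x (B (DT x h)) = A h /\<^sub>R H x ^ 4"
proof -
  have Hx: "H x > 0" "A x \<bullet> x = (H x)\<^sup>2"
    using energy_norm_pos[OF assms] energy_norm_power2 by auto
  have "B (DT x h) = h /\<^sub>R (H x)\<^sup>2 - (2 * (A x \<bullet> h) / H x ^ 4) *\<^sub>R x"
    by (simp add: DT_def)
  then show ?thesis
    using Hx by (simp add: DT_def inner_diff_right field_simps power2_eq_square power4_eq_xxxx algebra_simps)
qed

text \<open>The Jacobian of the inversion is read off from its conformality, without evaluating a
  determinant.\<close>

lemma linear_det_DT:
  assumes "x \<noteq> 0"
  shows "\<bar>linear_det (DT x)\<bar> = \<bar>linear_det A\<bar> / H x ^ (2 * DIM('a))"
proof -
  have Hx: "H x > 0"
    using energy_norm_pos[OF assms] .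
  have AB: "linear_det A * linear_det B = 1"
    using linear_det_compose[OF linear_A linear_B] by (simp add: comp_def linear_det_id)
  have "DT x \<circ> (B \<circ> DT x) = (\<lambda>v. (1 / H x ^ 4) *\<^sub>R v) \<circ> A"
    using DT_conformal[OF assms] by (simp add: fun_eq_iff divide_inverse)
  moreover have "linear ((\<lambda>v :: 'a. (1 / H x ^ 4) *\<^sub>R v))"
    by (rule linearI) (simp_all add: algebra_simps)
  ultimately have "linear_det (DT x) * (linear_det B * linear_det (DT x)) = (1 / H x ^ 4) ^ DIM('a) * linear_det A"
    using linear_det_compose[OF linear_DT linear_compose[OF linear_DT linear_B]]
      linear_det_compose[OF linear_B linear_DT] linear_det_compose[OF _ linear_A] linear_det_scaleR
    by metis
  \<comment> \<open>The determinants of \<open>A\<close> and \<open>B\<close> have product 1, so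
    multiplying by the former removes the latter. What is left is an equality of squares, which
    gives the Jacobian up to sign.\<close>
  then have "linear_det A * (linear_det (DT x) * (linear_det B * linear_det (DT x))) =
      linear_det A * ((1 / H x ^ 4) ^ DIM('a) * linear_det A)"
    by simp
  then have "(linear_det A * linear_det B) * (linear_det (DT x))\<^sup>2 = (1 / H x ^ 4) ^ DIM('a) * (linear_det A)\<^sup>2"
    by (simp add: power2_eq_square mult_ac)
  also have "(1 / H x ^ 4) ^ DIM('a) * (linear_det A)\<^sup>2 = (linear_det A / H x ^ (2 * DIM('a)))\<^sup>2"
    by (simp add: power_divide power_mult[symmetric] mult_ac)
  finally have "\<bar>linear_det (DT x)\<bar> = \<bar>linear_det A / H x ^ (2 * DIM('a))\<bar>"
    unfolding AB mult_1 power2_eq_iff abs_eq_iff .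
  then show ?thesis
    using Hx by simp
qed

end

section \<open>Weak gradients tested along the position vector\<close>

lemma C1_c_inner:
  fixes \<psi> :: "'a::euclidean_space \<Rightarrow> real"
  assumes "open \<Omega>" "\<psi> \<in> C1_c \<Omega>"
  shows "(\<lambda>x. (x \<bullet> e) * \<psi> x) \<in> C1_c \<Omega>"
    and "gradient (\<lambda>x. (x \<bullet> e) * \<psi> x) x = (x \<bullet> e) *\<^sub>R gradient \<psi> x + \<psi> x *\<^sub>R e"
proof -
  have coord: "GDERIV (\<lambda>x. x \<bullet> e) x :> e" for x :: 'a
    unfolding gderiv_def by (rule bounded_linear_imp_has_derivative) (rule bounded_linear_inner_left)
  show "(\<lambda>x. (x \<bullet> e) * \<psi> x) \<in> C1_c \<Omega>"
    by (rule C1_c_mult(1)[OF assms coord continuous_on_const])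
  show "gradient (\<lambda>x. (x \<bullet> e) * \<psi> x) x = (x \<bullet> e) *\<^sub>R gradient \<psi> x + \<psi> x *\<^sub>R e"
    by (rule gradient_eqI[OF GDERIV_mult[OF coord[of x] C1_c_gderiv[OF assms(2)]]])
qed

text \<open>The bracket on the left is the divergence of the field \<open>\<psi> x\<close>. Its
  component along each basis vector \<open>b\<close> is a test function for the direction
  \<open>b\<close>; the resulting identities are added up.\<close>

lemma weak_gradient_position:
  fixes v :: "'a::euclidean_space \<Rightarrow> real"
  assumes v: "has_weak_gradient \<Omega> v g" and \<Omega>: "open \<Omega>" and \<psi>: "\<psi> \<in> C1_c \<Omega>"
  shows "(\<integral>x. v x * (gradient \<psi> x \<bullet> x + real DIM('a) * \<psi> x) \<partial>lebesgue) = - (\<integral>x. \<psi> x * (g x \<bullet> x) \<partial>lebesgue)"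
proof -
  have L: "v \<in> Lp_loc 1 \<Omega>" "g \<in> Lp_loc 1 \<Omega>"
    and w: "\<And>\<phi> e. \<phi> \<in> C1_c \<Omega> \<Longrightarrow> (\<integral>x. v x * (gradient \<phi> x \<bullet> e) \<partial>lebesgue) = - (\<integral>x. \<phi> x * (g x \<bullet> e) \<partial>lebesgue)"
    using v by (auto simp: has_weak_gradient_iff)
  have \<psi>b: "(\<lambda>x. (x \<bullet> b) * \<psi> x) \<in> C1_c \<Omega>" for b
    by (rule C1_c_inner(1)[OF \<Omega> \<psi>])
  have grad: "gradient (\<lambda>x. (x \<bullet> b) * \<psi> x) x \<bullet> b = (gradient \<psi> x \<bullet> b) * (x \<bullet> b) + \<psi> x * (b \<bullet> b)" for b x
    unfolding C1_c_inner(2)[OF \<Omega> \<psi>] by (simp add: inner_add_left mult_ac)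
  have sum: "(\<Sum>b\<in>Basis. (x \<bullet> b) * \<psi> x * (g x \<bullet> b)) = \<psi> x * (g x \<bullet> x)" for x
    unfolding euclidean_inner[of "g x" x] by (simp add: sum_distrib_left mult_ac)
  have "(\<integral>x. v x * (gradient \<psi> x \<bullet> x + real DIM('a) * \<psi> x) \<partial>lebesgue) =
      (\<integral>x. (\<Sum>b\<in>Basis. v x * (gradient (\<lambda>x. (x \<bullet> b) * \<psi> x) x \<bullet> b)) \<partial>lebesgue)"
  proof (rule Bochner_Integration.integral_cong)
    fix x
    have "(\<Sum>b\<in>Basis. gradient (\<lambda>x. (x \<bullet> b) * \<psi> x) x \<bullet> b) = gradient \<psi> x \<bullet> x + real DIM('a) * \<psi> x"
      by (simp add: grad sum.distrib euclidean_inner[of "gradient \<psi> x" x])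
    then show "v x * (gradient \<psi> x \<bullet> x + real DIM('a) * \<psi> x) =
        (\<Sum>b\<in>Basis. v x * (gradient (\<lambda>x. (x \<bullet> b) * \<psi> x) x \<bullet> b))"
      by (simp add: sum_distrib_left[symmetric])
  qed simp
  also have "\<dots> = (\<Sum>b\<in>Basis. \<integral>x. v x * (gradient (\<lambda>x. (x \<bullet> b) * \<psi> x) x \<bullet> b) \<partial>lebesgue)"
  proof (rule Bochner_Integration.integral_sum)
    fix b :: 'a
    have "integrable lebesgue (\<lambda>x. v x *\<^sub>R gradient (\<lambda>x. (x \<bullet> b) * \<psi> x) x)"
      by (rule C1_c_integrable_gradient[OF bounded_bilinear.flip[OF bounded_bilinear_scaleR] L(1) \<psi>b])
    from integrable_inner_left[OF this, of b]
    show "integrable lebesgue (\<lambda>x. v x * (gradient (\<lambda>x. (x \<bullet> b) * \<psi> x) x \<bullet> b))"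
      by simp
  qed
  also have "\<dots> = (\<Sum>b\<in>Basis. - (\<integral>x. (x \<bullet> b) * \<psi> x * (g x \<bullet> b) \<partial>lebesgue))"
    by (simp only: w[OF \<psi>b])
  also have "\<dots> = - (\<integral>x. (\<Sum>b\<in>Basis. (x \<bullet> b) * \<psi> x * (g x \<bullet> b)) \<partial>lebesgue)"
  proof -
    have "integrable lebesgue (\<lambda>x. (x \<bullet> b) * \<psi> x * (g x \<bullet> b))" for b
      using integrable_inner_left[OF C1_c_integrable[OF L(2) \<psi>b], of b b] by simp
    then show ?thesis
      by (simp add: sum_negf)
  qed
  finally show ?thesis
    by (simp only: sum)
qed

section \<open>Measurability, integrals and local integrability under the inversion\<close>

context dual_forms
begin

abbreviation \<Omega> :: "'a set" where "\<Omega> \<equiv> UNIV - {0}"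
abbreviation DS where "DS \<equiv> dual.DT"

lemma open_punctured: "open \<Omega>"
  by auto

lemma inversion_image: "X \<subseteq> \<Omega> \<Longrightarrow> T ` X \<subseteq> \<Omega>"
  by auto

lemma inversion_image_inverse: "S ` T ` X = X"
  by (simp add: image_image)

lemma inversion_differentiable: "X \<subseteq> \<Omega> \<Longrightarrow> T differentiable_on X"
  using inversion_has_derivative unfolding differentiable_on_def differentiable_def
  by (metis DiffD2 insertI1 subsetD)

lemma inversion_continuous: "X \<subseteq> \<Omega> \<Longrightarrow> continuous_on X T"
  by (intro differentiable_imp_continuous_on inversion_differentiable)

lemma inversion_image_lebesgue: "X \<in> sets lebesgue \<Longrightarrow> X \<subseteq> \<Omega> \<Longrightarrow> T ` X \<in> sets lebesgue"
  by (rule differentiable_image_in_sets_lebesgue) (auto intro: inversion_differentiable)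

lemma inversion_image_compact: "compact K \<Longrightarrow> K \<subseteq> \<Omega> \<Longrightarrow> compact (T ` K)"
  by (intro compact_continuous_image inversion_continuous)

end

context dual_forms
begin

text \<open>The preimage of a Lebesgue set under \<open>T\<close> is an image under
  \<open>S\<close>, which is differentiable on the punctured space and so preserves Lebesgue
  sets.\<close>

lemma inversion_measurable:
  assumes X: "X \<in> sets lebesgue" "X \<subseteq> \<Omega>" and Y: "Y \<in> sets lebesgue" "T ` X \<subseteq> Y"
    and F: "F \<in> borel_measurable (lebesgue_on Y)"
  shows "(\<lambda>y. F (T y)) \<in> borel_measurable (lebesgue_on X)"
proof (rule measurable_compose[OF _ F], rule measurableI)
  fix Z assume "Z \<in> sets (lebesgue_on Y)"
  then have Z: "Z \<in> sets lebesgue"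
    using Y by (auto simp: sets_restrict_space)
  have "T -` Z \<inter> X = S ` (Z \<inter> T ` X)"
  proof (intro set_eqI iffI)
    fix y assume "y \<in> T -` Z \<inter> X"
    then show "y \<in> S ` (Z \<inter> T ` X)"
      by (intro image_eqI[of y S "T y"]) auto
  qed auto
  moreover have "S ` (Z \<inter> T ` X) \<in> sets lebesgue"
    using Z X inversion_image_lebesgue[OF X] inversion_image[OF X(2)]
    by (intro dual.inversion_image_lebesgue) auto
  ultimately have "T -` Z \<inter> X \<in> sets lebesgue"
    by simp
  then show "T -` Z \<inter> space (lebesgue_on X) \<in> sets (lebesgue_on X)"
    using X(1) by (simp add: sets_restrict_space_iff)
next
  fix x assume "x \<in> space (lebesgue_on X)"
  then show "T x \<in> space (lebesgue_on Y)"
    using Y(2) by auto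
qed

text \<open>The substitution is y = S x, whose Jacobian is \<open>linear_det_DT\<close> for the dual
  form. The constant \<open>linear_det B\<close> is nonzero, being invertible, and so disappears
  from the integrability criterion.\<close>

lemma set_integrable_inversion:
  fixes F :: "'a \<Rightarrow> real"
  assumes X: "X \<in> sets lebesgue" "X \<subseteq> \<Omega>"
  shows "set_integrable lebesgue X F \<longleftrightarrow>
      set_integrable lebesgue (T ` X) (\<lambda>x. F (S x) / q x ^ (2 * DIM('a)))"
    and "(LINT x:X|lebesgue. F x) =
      \<bar>linear_det B\<bar> * (LINT x:T ` X|lebesgue. F (S x) / q x ^ (2 * DIM('a)))"
proof -
  have X': "T ` X \<in> sets lebesgue"
    using inversion_image_lebesgue[OF X] .
  have der: "(S has_derivative DS x) (at x within T ` X)" if "x \<in> T ` X" for x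
    using that X by (intro dual.inversion_has_derivative) auto
  have inj: "inj_on S (T ` X)"
    by (auto simp: inj_on_def)
  have det: "linear_det A * linear_det B = 1"
    using linear_det_compose[OF linear_A linear_B] by (simp add: comp_def linear_det_id)
  then have nz: "\<bar>linear_det B\<bar> \<noteq> 0"
    by auto
  have eq: "\<bar>linear_det (DS x)\<bar> * F (S x) = \<bar>linear_det B\<bar> * (F (S x) / q x ^ (2 * DIM('a)))"
    if "x \<in> T ` X" for x
  proof -
    have "x \<noteq> 0"
      using that X(2) by auto
    then show ?thesis
      using dual.linear_det_DT[of x] by simp
  qed
  have "set_integrable lebesgue X F \<longleftrightarrow>
      set_integrable lebesgue (T ` X) (\<lambda>x. \<bar>linear_det (DS x)\<bar> * F (S x))"
    by (rule euclidean_change_of_variables(1)[OF X' der inj, unfolded inversion_image_inverse])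
  also have "\<dots> \<longleftrightarrow> set_integrable lebesgue (T ` X) (\<lambda>x. \<bar>linear_det B\<bar> * (F (S x) / q x ^ (2 * DIM('a))))"
    by (rule set_integrable_cong[OF refl refl]) (rule eq)
  also have "\<dots> \<longleftrightarrow> set_integrable lebesgue (T ` X) (\<lambda>x. F (S x) / q x ^ (2 * DIM('a)))"
    using nz by (rule set_integrable_mult_right_iff)
  finally show "set_integrable lebesgue X F \<longleftrightarrow>
      set_integrable lebesgue (T ` X) (\<lambda>x. F (S x) / q x ^ (2 * DIM('a)))" .
  have "(LINT x:X|lebesgue. F x) = (LINT x:T ` X|lebesgue. \<bar>linear_det (DS x)\<bar> * F (S x))"
    by (rule euclidean_change_of_variables(2)[OF X' der inj, unfolded inversion_image_inverse])
  also have "\<dots> = (LINT x:T ` X|lebesgue. \<bar>linear_det B\<bar> * (F (S x) / q x ^ (2 * DIM('a))))"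
    by (rule set_lebesgue_integral_cong[OF X']) (use eq in blast)
  also have "\<dots> = \<bar>linear_det B\<bar> * (LINT x:T ` X|lebesgue. F (S x) / q x ^ (2 * DIM('a)))"
    by (rule set_integral_mult_right)
  finally show "(LINT x:X|lebesgue. F x) =
      \<bar>linear_det B\<bar> * (LINT x:T ` X|lebesgue. F (S x) / q x ^ (2 * DIM('a)))" .
qed

text \<open>A value 0 at the origin lets integrals over the punctured space be written over the
  whole space; \<open>S 0 = 0\<close> does the same for the transformed integrand. The integrands to
  come carry a test function or its gradient, both of which vanish there.\<close>

lemma integral_inversion:
  fixes F :: "'a \<Rightarrow> real"
  assumes "F 0 = 0"
  shows "integral\<^sup>L lebesgue F =
      \<bar>linear_det B\<bar> * integral\<^sup>L lebesgue (\<lambda>x. F (S x) / q x ^ (2 * DIM('a)))"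
proof -
  have T: "T ` \<Omega> = \<Omega>"
  proof (intro set_eqI iffI)
    fix y assume "y \<in> \<Omega>"
    then show "y \<in> T ` \<Omega>"
      by (intro image_eqI[of y T "S y"]) auto
  qed auto
  have S0: "S 0 = 0"
    by (simp add: inversion_def)
  have "(LINT x:\<Omega>|lebesgue. F x) =
      \<bar>linear_det B\<bar> * (LINT x:\<Omega>|lebesgue. F (S x) / q x ^ (2 * DIM('a)))"
    using set_integrable_inversion(2)[of \<Omega> F] by (simp add: T)
  moreover have "(LINT x:\<Omega>|lebesgue. F x) = integral\<^sup>L lebesgue F"
    by (rule set_lebesgue_integral_supported) (use assms in auto)
  moreover have "(LINT x:\<Omega>|lebesgue. F (S x) / q x ^ (2 * DIM('a))) =
      integral\<^sup>L lebesgue (\<lambda>x. F (S x) / q x ^ (2 * DIM('a)))"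
    by (rule set_lebesgue_integral_supported) (simp add: assms S0)
  ultimately show ?thesis
    by simp
qed

text \<open>A compact set that avoids the origin has a compact image that avoids it too, and there
  the Jacobian weight is bounded.\<close>

lemma inversion_Lp_loc:
  fixes F :: "'a \<Rightarrow> 'b::euclidean_space"
  assumes F: "F \<in> Lp_loc p UNIV"
  shows "(\<lambda>y. F (T y)) \<in> Lp_loc p \<Omega>"
  unfolding Lp_loc_def
proof (intro CollectI allI impI, elim conjE)
  fix K :: "'a set" assume K: "compact K" "K \<subseteq> \<Omega>"
  have TK: "compact (T ` K)" "T ` K \<subseteq> \<Omega>"
    using K by (auto intro: inversion_image_compact)
  have meas: "K \<in> sets lebesgue" "T ` K \<in> sets lebesgue"
    using K TK by (auto intro: fmeasurableD lmeasurable_compact)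
  have FK: "F \<in> borel_measurable (lebesgue_on (T ` K))"
      "integrable (lebesgue_on (T ` K)) (\<lambda>x. norm (F x) powr p)"
    using F TK meas by (auto simp: Lp_loc_def Lp_iff_lebesgue_on)
  have q0: "q x \<noteq> 0" if "x \<in> T ` K" for x
  proof -
    have "x \<noteq> 0"
      using that TK(2) by blast
    then show ?thesis
      using dual.energy_norm_pos[of x] by simp
  qed
  have cont: "continuous_on (T ` K) (\<lambda>x. 1 / q x ^ (2 * DIM('a)))"
    by (intro continuous_intros dual.continuous_on_energy_norm) (use q0 in auto)
  then have "compact ((\<lambda>x. 1 / q x ^ (2 * DIM('a))) ` T ` K)"
    using TK(1) by (rule compact_continuous_image)
  then obtain C where C: "\<And>x. x \<in> T ` K \<Longrightarrow> norm (1 / q x ^ (2 * DIM('a))) \<le> C"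
    by (meson bounded_iff compact_imp_bounded imageI)
  have "integrable (lebesgue_on (T ` K)) (\<lambda>x. norm (F x) powr p / q x ^ (2 * DIM('a)))"
  proof (rule Bochner_Integration.integrable_bound)
    show "integrable (lebesgue_on (T ` K)) (\<lambda>x. C * norm (F x) powr p)"
      using FK by simp
    have "(\<lambda>x. 1 / q x ^ (2 * DIM('a))) \<in> borel_measurable (lebesgue_on (T ` K))"
      using cont meas continuous_imp_measurable_on_sets_lebesgue by blast
    from borel_measurable_times[OF borel_measurable_integrable[OF FK(2)] this]
    show "(\<lambda>x. norm (F x) powr p / q x ^ (2 * DIM('a))) \<in> borel_measurable (lebesgue_on (T ` K))"
      by simp
    show "AE x in lebesgue_on (T ` K). norm (norm (F x) powr p / q x ^ (2 * DIM('a))) \<le>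
        norm (C * norm (F x) powr p)"
    proof (rule AE_I2)
      fix x assume "x \<in> space (lebesgue_on (T ` K))"
      then have "norm (1 / q x ^ (2 * DIM('a))) \<le> C"
        using C meas by simp
      then have "norm (1 / q x ^ (2 * DIM('a))) * norm (F x) powr p \<le> C * norm (F x) powr p"
        by (intro mult_right_mono) auto
      also have "\<dots> \<le> norm (C * norm (F x) powr p)"
        by simp
      finally show "norm (norm (F x) powr p / q x ^ (2 * DIM('a))) \<le> norm (C * norm (F x) powr p)"
        by (simp add: mult_ac divide_inverse abs_mult)
    qed
  qed
  then have "set_integrable lebesgue (T ` K) (\<lambda>x. norm (F x) powr p / q x ^ (2 * DIM('a)))"
    using meas by (simp add: set_integrable_def integrable_restrict_space)
  then have "set_integrable lebesgue K (\<lambda>y. norm (F (T y)) powr p)"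
    using set_integrable_inversion(1)[OF meas(1) K(2), of "\<lambda>y. norm (F (T y)) powr p"] by simp
  moreover have "(\<lambda>y. F (T y)) \<in> borel_measurable (lebesgue_on K)"
    using inversion_measurable[OF meas(1) K(2) meas(2) order_refl FK(1)] .
  ultimately show "(\<lambda>y. F (T y)) \<in> Lp p K"
    by (simp add: Lp_def)
qed

end

section \<open>Test functions under the inversion\<close>

context dual_forms
begin

text \<open>\<open>DT (S x)\<close> and \<open>DS x\<close> are derivatives of mutually inverse maps
  at corresponding points. Since \<open>H (S x) = 1 / q x\<close>, the derivative of
  \<open>T\<close> has no denominators when expressed in \<open>x\<close>, and the inverse relation
  is checked on that formula.\<close>

lemma DS_DT: "x \<noteq> 0 \<Longrightarrow> DS x (DT (S x) e) = e"
  and DT_inversion: "x \<noteq> 0 \<Longrightarrow> DT (S x) e = (q x)\<^sup>2 *\<^sub>R A e - (2 * (x \<bullet> e)) *\<^sub>R x"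
proof -
  assume x: "x \<noteq> 0"
  have q: "q x > 0"
    using dual.energy_norm_pos[OF x] .
  have Bx: "B x \<bullet> x = (q x)\<^sup>2"
    by (simp add: dual.energy_norm_power2)
  have AS: "A (S x) = x /\<^sub>R (q x)\<^sup>2"
    by (simp add: dual.inversion_eq)
  show 1: "DT (S x) e = (q x)\<^sup>2 *\<^sub>R A e - (2 * (x \<bullet> e)) *\<^sub>R x"
    using q by (simp add: DT_def dual.energy_norm_inversion AS field_simps power2_eq_square power4_eq_xxxx)
  have 2: "B (DT (S x) e) = (q x)\<^sup>2 *\<^sub>R e - (2 * (x \<bullet> e)) *\<^sub>R B x"
    by (simp add: 1)
  have 3: "B x \<bullet> DT (S x) e = - ((q x)\<^sup>2 * (x \<bullet> e))"
    by (simp add: 1 inner_diff_right B_inner_A Bx algebra_simps)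
  show "DS x (DT (S x) e) = e"
    unfolding dual.DT_def 2 3
    using q by (simp add: dual.DT_def field_simps power2_eq_square power4_eq_xxxx)
qed

lemma continuous_on_DT: "continuous_on \<Omega> g \<Longrightarrow> continuous_on \<Omega> (\<lambda>x. DT x (g x))"
  unfolding DT_def
  by (intro continuous_intros continuous_on_energy_norm linear_continuous_on_compose[OF _ linear_A])
     (use energy_norm_pos in \<open>force simp: linear_continuous_on bounded_linear_A\<close>)+

lemma C1_c_inversion:
  assumes \<phi>: "\<phi> \<in> C1_c \<Omega>"
  shows "(\<lambda>x. \<phi> (T x)) \<in> C1_c \<Omega>"
    and "x \<noteq> 0 \<Longrightarrow> gradient (\<lambda>x. \<phi> (T x)) x = DT x (gradient \<phi> (T x))"
proof -
  obtain K where K: "compact K" "K \<subseteq> \<Omega>" "\<forall>x. x \<notin> K \<longrightarrow> \<phi> x = 0 \<and> gradient \<phi> x = 0"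
    by (rule C1_c_support[OF \<phi>])
  have D: "GDERIV (\<lambda>x. \<phi> (T x)) x :> DT x (gradient \<phi> (T x))" if "x \<in> \<Omega>" for x
  proof -
    have "((\<lambda>x. \<phi> (T x)) has_derivative (\<lambda>h. DT x h \<bullet> gradient \<phi> (T x))) (at x)"
      using has_derivative_compose[OF inversion_has_derivative[of x UNIV] C1_c_gderiv[OF \<phi>, unfolded gderiv_def]] that
      by simp
    then show ?thesis
      by (simp add: gderiv_def DT_sym)
  qed
  have 0: "\<phi> (T x) = 0" if "x \<notin> S ` K" for x
  proof -
    have "T x \<notin> K"
      using that by (metis image_eqI inversion_inverse)
    then show ?thesis
      using K(3) by simp
  qed
  have SK: "compact (S ` K)" "S ` K \<subseteq> \<Omega>"
    using K by (auto intro: dual.inversion_image_compact)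
  have "continuous_on \<Omega> (\<lambda>x. gradient \<phi> (T x))"
    by (rule continuous_on_compose2[OF C1_c_continuous_gradient[OF \<phi>] inversion_continuous]) auto
  then have "continuous_on \<Omega> (\<lambda>x. DT x (gradient \<phi> (T x)))"
    by (rule continuous_on_DT)
  with D 0 show "(\<lambda>x. \<phi> (T x)) \<in> C1_c \<Omega>"
    by (intro C1_cI[OF open_punctured SK])
  show "x \<noteq> 0 \<Longrightarrow> gradient (\<lambda>x. \<phi> (T x)) x = DT x (gradient \<phi> (T x))"
    using gradient_eqI[OF D] by simp
qed

lemma C1_c_div_power:
  assumes \<psi>: "\<psi> \<in> C1_c \<Omega>"
  shows "(\<lambda>x. \<psi> x / H x ^ k) \<in> C1_c \<Omega>"
    and "x \<noteq> 0 \<Longrightarrow> gradient (\<lambda>x. \<psi> x / H x ^ k) x =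
      gradient \<psi> x /\<^sub>R H x ^ k - (real k * \<psi> x / H x ^ (k + 2)) *\<^sub>R A x"
proof -
  have cont: "continuous_on \<Omega> (\<lambda>x. (- real k / H x ^ (k + 2)) *\<^sub>R A x)"
    by (intro continuous_intros continuous_on_energy_norm linear_continuous_on bounded_linear_A)
      (use energy_norm_pos in force)
  have der: "GDERIV (\<lambda>x. 1 / H x ^ k) x :> (- real k / H x ^ (k + 2)) *\<^sub>R A x" if "x \<in> \<Omega>" for x
    using that by (intro inverse_power_gderiv) auto
  have eq: "(\<lambda>x. 1 / H x ^ k * \<psi> x) = (\<lambda>x. \<psi> x / H x ^ k)"
    by simp
  show "(\<lambda>x. \<psi> x / H x ^ k) \<in> C1_c \<Omega>"
    using C1_c_mult(1)[OF open_punctured \<psi> der cont] by (simp only: eq)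
  show "gradient (\<lambda>x. \<psi> x / H x ^ k) x =
      gradient \<psi> x /\<^sub>R H x ^ k - (real k * \<psi> x / H x ^ (k + 2)) *\<^sub>R A x" if "x \<noteq> 0"
    using C1_c_mult(2)[OF open_punctured \<psi> der cont, of x] that by (simp add: eq divide_inverse mult_ac)
qed

end

section \<open>The Kelvin transform\<close>

text \<open>Writing the dimension as \<open>m + 2\<close> turns the exponents into sums, free of
  natural number subtraction. As weak gradients are relational, one representative \<open>g\<close>
  is fixed.\<close>

locale kelvin = dual_forms A B for A B :: "'a::euclidean_space \<Rightarrow> 'a" +
  fixes u :: "'a \<Rightarrow> real" and g :: "'a \<Rightarrow> 'a" and m :: nat
  assumes dim: "DIM('a) = m + 2"
    and weak: "has_weak_gradient UNIV u g"
begin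

definition uK :: "'a \<Rightarrow> real" where
  "uK y = u (T y) / H y ^ m"

text \<open>The chain and product rules applied formally to \<open>uK\<close>, where
  \<open>DT y\<close> stands for its own transpose by \<open>DT_sym\<close>. That it is a weak
  gradient is the content of \<open>kelvin_weak_gradient_identity\<close>.\<close>

definition gK :: "'a \<Rightarrow> 'a" where
  "gK y = DT y (g (T y)) /\<^sub>R H y ^ m - (real m * u (T y) / H y ^ (m + 2)) *\<^sub>R A y"

lemma uK_inversion: "x \<noteq> 0 \<Longrightarrow> uK (S x) = u x * q x ^ m"
  using dual.energy_norm_pos[of x] by (simp add: uK_def dual.energy_norm_inversion power_divide)

lemma gK_inversion:
  assumes "x \<noteq> 0"
  shows "gK (S x) = q x ^ m *\<^sub>R ((q x)\<^sup>2 *\<^sub>R A (g x) - (2 * (x \<bullet> g x) + real m * u x) *\<^sub>R x)"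
proof -
  have q: "q x > 0"
    using dual.energy_norm_pos[OF assms] .
  have "A (S x) = x /\<^sub>R (q x)\<^sup>2"
    by (simp add: dual.inversion_eq)
  with q show ?thesis
    by (simp add: gK_def dual.energy_norm_inversion DT_inversion[OF assms] power_divide
        algebra_simps power_add power2_eq_square) (simp add: field_simps)
qed

lemma weak_gradient_restricted: "has_weak_gradient \<Omega> u g"
  using weak has_weak_gradient_subset by blast

lemma u_g_Lp_loc: "u \<in> Lp_loc 1 \<Omega>" "g \<in> Lp_loc 1 \<Omega>"
  using weak_gradient_restricted by (simp_all add: has_weak_gradient_iff)

lemma integrable_test:
  assumes "\<psi> \<in> C1_c \<Omega>"
  shows "integrable lebesgue (\<lambda>x. u x * \<psi> x)"
    and "integrable lebesgue (\<lambda>x. \<psi> x * (g x \<bullet> e))"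
    and "integrable lebesgue (\<lambda>x. \<psi> x * (g x \<bullet> x))"
    and "integrable lebesgue (\<lambda>x. u x * (gradient \<psi> x \<bullet> e))"
    and "integrable lebesgue (\<lambda>x. u x * (gradient \<psi> x \<bullet> x + real DIM('a) * \<psi> x))"
proof -
  show 1: "integrable lebesgue (\<lambda>x. u x * \<psi> x)"
    using C1_c_integrable[OF u_g_Lp_loc(1) assms] by (simp add: mult.commute)
  show "integrable lebesgue (\<lambda>x. \<psi> x * (g x \<bullet> e))"
    using integrable_inner_left[OF C1_c_integrable[OF u_g_Lp_loc(2) assms], of e] by simp
  obtain K where K: "compact K" "K \<subseteq> \<Omega>" "\<forall>x. x \<notin> K \<longrightarrow> \<psi> x = 0 \<and> gradient \<psi> x = 0"
    by (rule C1_c_support[OF assms])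
  have "integrable lebesgue (\<lambda>x. (\<psi> x *\<^sub>R x) \<bullet> g x)"
    by (rule Lp_loc_integrable_bilinear[OF bounded_bilinear_inner u_g_Lp_loc(2) _ K(1,2)])
      (use K(3) C1_c_continuous[OF assms] in \<open>auto intro!: continuous_intros\<close>)
  then show "integrable lebesgue (\<lambda>x. \<psi> x * (g x \<bullet> x))"
    by (simp add: inner_commute)
  have "integrable lebesgue (\<lambda>x. (gradient \<psi> x \<bullet> e) *\<^sub>R u x)"
    by (rule Lp_loc_integrable_bilinear[OF bounded_bilinear_scaleR u_g_Lp_loc(1) _ K(1,2)])
      (use K(3) C1_c_continuous_gradient[OF assms] in \<open>auto intro!: continuous_intros\<close>)
  then show "integrable lebesgue (\<lambda>x. u x * (gradient \<psi> x \<bullet> e))"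
    by (simp add: mult.commute)
  have "integrable lebesgue (\<lambda>x. (gradient \<psi> x \<bullet> x + real DIM('a) * \<psi> x) *\<^sub>R u x)"
    by (rule Lp_loc_integrable_bilinear[OF bounded_bilinear_scaleR u_g_Lp_loc(1) _ K(1,2)])
      (use K(3) C1_c_continuous_gradient[OF assms] C1_c_continuous[OF assms] in \<open>auto intro!: continuous_intros\<close>)
  then show "integrable lebesgue (\<lambda>x. u x * (gradient \<psi> x \<bullet> x + real DIM('a) * \<psi> x))"
    by (simp add: mult.commute)
qed

lemma weak_identity_const:
  "\<psi> \<in> C1_c \<Omega> \<Longrightarrow> (\<integral>x. u x * (gradient \<psi> x \<bullet> e) \<partial>lebesgue) = - (\<integral>x. \<psi> x * (g x \<bullet> e) \<partial>lebesgue)"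
  using weak_gradient_restricted unfolding has_weak_gradient_iff by blast

lemmas weak_identity_position = weak_gradient_position[OF weak_gradient_restricted open_punctured]

text \<open>The chain rule gives the gradient of the transported function as \<open>DS x\<close>
  applied to that of \<open>\<phi>\<close> at \<open>S x\<close>; symmetry of \<open>DS x\<close>
  and \<open>DS_DT\<close> undo this.\<close>

lemma gradient_inversion_inner:
  assumes \<phi>: "\<phi> \<in> C1_c \<Omega>" and x: "x \<noteq> 0"
  shows "gradient \<phi> (S x) \<bullet> e =
    gradient (\<lambda>x. \<phi> (S x)) x \<bullet> ((q x)\<^sup>2 *\<^sub>R A e - (2 * (x \<bullet> e)) *\<^sub>R x)"
proof -
  have "gradient (\<lambda>x. \<phi> (S x)) x \<bullet> DT (S x) e = gradient \<phi> (S x) \<bullet> e"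
    by (simp add: dual.C1_c_inversion(2)[OF \<phi> x] dual.DT_sym DS_DT[OF x])
  then show ?thesis
    by (simp add: DT_inversion[OF x])
qed

lemma kelvin_weak_gradient_identity:
  assumes \<phi>: "\<phi> \<in> C1_c \<Omega>"
  shows "(\<integral>y. uK y * (gradient \<phi> y \<bullet> e) \<partial>lebesgue) = - (\<integral>y. \<phi> y * (gK y \<bullet> e) \<partial>lebesgue)"
proof -
  define \<psi> where "\<psi> = (\<lambda>x. \<phi> (S x))"
  have \<psi>: "\<psi> \<in> C1_c \<Omega>"
    unfolding \<psi>_def by (rule dual.C1_c_inversion(1)[OF \<phi>])
  \<comment> \<open>Transported by \<open>S\<close>, the derivative of \<open>\<phi>\<close> in the direction \<open>e\<close>, times the Jacobian and the
    weight of the Kelvin transform, is the derivative of \<open>\<psi>\<close> along the field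
    \<open>A e / q\<^sup>N - 2 (x \<bullet> e) x / q\<^bsup>N+2\<^esup>\<close>; this dictates the test functions \<open>\<psi>1\<close> and \<open>\<psi>2\<close>.\<close>
  define \<psi>1 where "\<psi>1 = (\<lambda>x. \<psi> x / q x ^ (m + 2))"
  define \<psi>2' where "\<psi>2' = (\<lambda>x. \<psi> x / q x ^ (m + 4))"
  define \<psi>2 where "\<psi>2 = (\<lambda>x. (x \<bullet> e) * \<psi>2' x)"
  have C: "\<psi>1 \<in> C1_c \<Omega>" "\<psi>2' \<in> C1_c \<Omega>"
    unfolding \<psi>1_def \<psi>2'_def by (rule dual.C1_c_div_power(1)[OF \<psi>])+
  then have C2: "\<psi>2 \<in> C1_c \<Omega>"
    unfolding \<psi>2_def using C1_c_inner(1)[OF open_punctured] by blast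
  have zero: "\<phi> 0 = 0" "gradient \<phi> 0 = 0" and \<psi>0: "\<psi> 0 = 0"
    using C1_c_zero[OF \<phi>] C1_c_zero[OF \<psi>] by auto
  have grad0: "gradient \<psi>1 0 = 0" "gradient \<psi>2 0 = 0"
    using C1_c_zero(2)[OF C(1)] C1_c_zero(2)[OF C2] by auto
  let ?d = "\<bar>linear_det B\<bar>"
  \<comment> \<open>The first two terms are \<open>u\<close> times the divergence of
    \<open>\<psi>\<close> times the transported field. The field itself has divergence
    \<open>- m (x \<bullet> e) / q^(m+4)\<close>, which the last term compensates; in
    \<open>R\<close> the same term comes from the zero-order part of \<open>gK\<close>.\<close>
  have L: "uK (S x) * (gradient \<phi> (S x) \<bullet> e) / q x ^ (2 * DIM('a)) =
      u x * (gradient \<psi>1 x \<bullet> A e) - 2 * (u x * (gradient \<psi>2 x \<bullet> x + real DIM('a) * \<psi>2 x))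
        + real m * (u x * \<psi>2 x)" for x
  proof (cases "x = 0")
    case True
    then show ?thesis
      using zero grad0 \<psi>0 by (simp add: inversion_def[of B] \<psi>2_def)
  next
    case False
    have q: "q x > 0" "B x \<bullet> x = (q x)\<^sup>2" "B x \<bullet> A e = x \<bullet> e"
      using dual.energy_norm_pos[OF False] by (simp_all add: dual.energy_norm_power2 B_inner_A)
    have g1: "gradient \<psi>1 x = gradient \<psi> x /\<^sub>R q x ^ (m + 2) - (real (m + 2) * \<psi> x / q x ^ (m + 4)) *\<^sub>R B x"
      unfolding \<psi>1_def using dual.C1_c_div_power(2)[OF \<psi> False, of "m + 2"] by (simp add: numeral_eq_Suc)
    have g2': "gradient \<psi>2' x = gradient \<psi> x /\<^sub>R q x ^ (m + 4) - (real (m + 4) * \<psi> x / q x ^ (m + 6)) *\<^sub>R B x"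
      unfolding \<psi>2'_def using dual.C1_c_div_power(2)[OF \<psi> False, of "m + 4"] by (simp add: numeral_eq_Suc)
    have g2: "gradient \<psi>2 x = (x \<bullet> e) *\<^sub>R gradient \<psi>2' x + \<psi>2' x *\<^sub>R e"
      unfolding \<psi>2_def by (rule C1_c_inner(2)[OF open_punctured C(2)])
    define a where "a = gradient \<psi> x \<bullet> A e"
    define b where "b = gradient \<psi> x \<bullet> x"
    define c where "c = x \<bullet> e"
    define Q where "Q = q x ^ m"
    have Q: "Q > 0"
      using q by (simp add: Q_def)
    have e1: "gradient \<psi>1 x \<bullet> A e = a / (Q * (q x)\<^sup>2) - real (m + 2) * \<psi> x * c / (Q * q x ^ 4)"
      by (simp add: g1 inner_diff_left q a_def c_def Q_def power_add power2_eq_square divide_inverse mult_ac)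
    have v: "\<psi>2' x = \<psi> x / (Q * q x ^ 4)"
      by (simp add: \<psi>2'_def Q_def power_add)
    have e2: "gradient \<psi>2 x \<bullet> x = c * (b / (Q * q x ^ 4)) - c * real (m + 4) * \<psi> x * (q x)\<^sup>2 / (Q * q x ^ 6)
        + c * \<psi> x / (Q * q x ^ 4)"
      by (simp add: g2 g2' inner_diff_left inner_add_left q b_def c_def Q_def v power_add
          inner_commute[of e x] divide_inverse algebra_simps)
    have e3: "\<psi>2 x = c * \<psi> x / (Q * q x ^ 4)"
      by (simp add: \<psi>2_def \<psi>2'_def c_def Q_def power_add)
    have e4: "gradient \<phi> (S x) \<bullet> e = (q x)\<^sup>2 * a - 2 * c * b"
      using gradient_inversion_inner[OF \<phi> False, of e]
      by (simp add: \<psi>_def[symmetric] inner_diff_right a_def b_def c_def)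
    have e5: "q x ^ (2 * DIM('a)) = Q * Q * q x ^ 4"
    proof -
      have "2 * DIM('a) = m + m + 4"
        using dim by simp
      then show ?thesis
        by (simp only: Q_def power_add)
    qed
    show ?thesis
      unfolding e5 unfolding e1 e2 e3 e4 uK_inversion[OF False] Q_def[symmetric] dim
      using q(1) Q by (simp add: field_simps power2_eq_square power_numeral_reduce)
  qed
  have R: "\<phi> (S x) * (gK (S x) \<bullet> e) / q x ^ (2 * DIM('a)) =
      \<psi>1 x * (g x \<bullet> A e) - 2 * (\<psi>2' x * (x \<bullet> e) * (g x \<bullet> x)) - real m * (u x * \<psi>2 x)" for x
  proof (cases "x = 0")
    case True
    then show ?thesis
      using zero \<psi>0 by (simp add: inversion_def[of B] \<psi>1_def \<psi>2_def)
  next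
    case False
    have q: "q x > 0"
      using dual.energy_norm_pos[OF False] .
    define Q where "Q = q x ^ m"
    have Q: "Q > 0"
      using q by (simp add: Q_def)
    have e5: "q x ^ (2 * DIM('a)) = Q * Q * q x ^ 4"
    proof -
      have "2 * DIM('a) = m + m + 4"
        using dim by simp
      then show ?thesis
        by (simp only: Q_def power_add)
    qed
    have e1: "gK (S x) \<bullet> e = Q * ((q x)\<^sup>2 * (g x \<bullet> A e) - (2 * (g x \<bullet> x) + real m * u x) * (x \<bullet> e))"
      by (simp add: gK_inversion[OF False] inner_diff_left A_sym Q_def inner_commute[of x "g x"])
    have e2: "\<psi>1 x = \<psi> x / (Q * (q x)\<^sup>2)" "\<psi>2' x = \<psi> x / (Q * q x ^ 4)" "\<psi>2 x = (x \<bullet> e) * \<psi> x / (Q * q x ^ 4)"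
      by (simp_all add: \<psi>1_def \<psi>2_def \<psi>2'_def Q_def power_add power2_eq_square)
    show ?thesis
      unfolding e1 e2 e5 \<psi>_def[symmetric]
      using q(1) Q by (simp add: \<psi>_def field_simps power2_eq_square power_numeral_reduce)
  qed
  have \<psi>2_comm: "\<psi>2' x * (x \<bullet> e) = \<psi>2 x" for x
    by (simp add: \<psi>2_def)
  have "(\<integral>y. uK y * (gradient \<phi> y \<bullet> e) \<partial>lebesgue) =
      ?d * (\<integral>x. u x * (gradient \<psi>1 x \<bullet> A e) - 2 * (u x * (gradient \<psi>2 x \<bullet> x + real DIM('a) * \<psi>2 x))
        + real m * (u x * \<psi>2 x) \<partial>lebesgue)"
    using integral_inversion[of "\<lambda>y. uK y * (gradient \<phi> y \<bullet> e)"] zero by (simp only: L) simp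
  also have "(\<integral>x. u x * (gradient \<psi>1 x \<bullet> A e) - 2 * (u x * (gradient \<psi>2 x \<bullet> x + real DIM('a) * \<psi>2 x))
        + real m * (u x * \<psi>2 x) \<partial>lebesgue) =
      (\<integral>x. u x * (gradient \<psi>1 x \<bullet> A e) \<partial>lebesgue)
        - 2 * (\<integral>x. u x * (gradient \<psi>2 x \<bullet> x + real DIM('a) * \<psi>2 x) \<partial>lebesgue)
        + real m * (\<integral>x. u x * \<psi>2 x \<partial>lebesgue)"
    using integrable_test[OF C(1)] integrable_test[OF C2] by simp
  also have "\<dots> = - ((\<integral>x. \<psi>1 x * (g x \<bullet> A e) \<partial>lebesgue) - 2 * (\<integral>x. \<psi>2 x * (g x \<bullet> x) \<partial>lebesgue)
        - real m * (\<integral>x. u x * \<psi>2 x \<partial>lebesgue))"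
    unfolding weak_identity_const[OF C(1)] weak_identity_position[OF C2] by simp
  also have "(\<integral>x. \<psi>1 x * (g x \<bullet> A e) \<partial>lebesgue) - 2 * (\<integral>x. \<psi>2 x * (g x \<bullet> x) \<partial>lebesgue)
        - real m * (\<integral>x. u x * \<psi>2 x \<partial>lebesgue) =
      (\<integral>x. \<psi>1 x * (g x \<bullet> A e) - 2 * (\<psi>2 x * (g x \<bullet> x)) - real m * (u x * \<psi>2 x) \<partial>lebesgue)"
    using integrable_test[OF C(1)] integrable_test[OF C2] by simp
  also have "?d * - \<dots> = - (\<integral>y. \<phi> y * (gK y \<bullet> e) \<partial>lebesgue)"
    using integral_inversion[of "\<lambda>y. \<phi> y * (gK y \<bullet> e)"] zero by (simp only: R \<psi>2_comm mult_minus_right mult_zero_left)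
  finally show ?thesis .
qed

end

section \<open>The dual equation\<close>

context kelvin
begin

text \<open>The original equation is tested with \<open>\<psi>3\<close>. The gradient of its weight
  adds a term in \<open>g x \<bullet> x\<close>, and \<open>gK\<close> leaves a term in
  \<open>u x * (gradient \<psi> x \<bullet> x)\<close>; together they are \<open>m\<close> times the
  formal divergence of \<open>u \<psi>1 x\<close>, whose integral vanishes.\<close>

lemma kelvin_weak_equation:
  assumes eq: "\<And>\<psi>. \<psi> \<in> C1_c \<Omega> \<Longrightarrow>
      (\<integral>x. A (g x) \<bullet> gradient \<psi> x \<partial>lebesgue) = (\<integral>x. f x * \<psi> x \<partial>lebesgue)"
    and \<phi>: "\<phi> \<in> C1_c \<Omega>"
  shows "(\<integral>y. B (gK y) \<bullet> gradient \<phi> y \<partial>lebesgue) = (\<integral>y. f (T y) / H y ^ (m + 4) * \<phi> y \<partial>lebesgue)"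
proof -
  define \<psi> where "\<psi> = (\<lambda>x. \<phi> (S x))"
  have \<psi>: "\<psi> \<in> C1_c \<Omega>"
    unfolding \<psi>_def by (rule dual.C1_c_inversion(1)[OF \<phi>])
  define \<psi>1 where "\<psi>1 = (\<lambda>x. \<psi> x / q x ^ (m + 2))"
  define \<psi>3 where "\<psi>3 = (\<lambda>x. \<psi> x / q x ^ m)"
  have C: "\<psi>1 \<in> C1_c \<Omega>" "\<psi>3 \<in> C1_c \<Omega>"
    unfolding \<psi>1_def \<psi>3_def by (rule dual.C1_c_div_power(1)[OF \<psi>])+
  have zero: "\<phi> 0 = 0" "gradient \<phi> 0 = 0" and \<psi>0: "\<psi> 0 = 0"
    using C1_c_zero[OF \<phi>] C1_c_zero[OF \<psi>] by auto
  have grad0: "gradient \<psi>1 0 = 0" "gradient \<psi>3 0 = 0"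
    using C1_c_zero(2)[OF C(1)] C1_c_zero(2)[OF C(2)] by auto
  let ?d = "\<bar>linear_det B\<bar>"
  have L: "B (gK (S x)) \<bullet> gradient \<phi> (S x) / q x ^ (2 * DIM('a)) =
      A (g x) \<bullet> gradient \<psi>3 x + real m * (\<psi>1 x * (g x \<bullet> x))
        + real m * (u x * (gradient \<psi>1 x \<bullet> x + real DIM('a) * \<psi>1 x))" for x
  proof (cases "x = 0")
    case True
    then show ?thesis
      using zero grad0 \<psi>0 by (simp add: inversion_def[of B] \<psi>1_def)
  next
    case False
    have q: "q x > 0" "B x \<bullet> x = (q x)\<^sup>2" "x \<bullet> B x = (q x)\<^sup>2"
      using dual.energy_norm_pos[OF False] by (simp_all add: dual.energy_norm_power2 inner_commute)
    have g1: "gradient \<psi>1 x = gradient \<psi> x /\<^sub>R q x ^ (m + 2) - (real (m + 2) * \<psi> x / q x ^ (m + 4)) *\<^sub>R B x"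
      unfolding \<psi>1_def using dual.C1_c_div_power(2)[OF \<psi> False, of "m + 2"] by (simp add: numeral_eq_Suc)
    have g3: "gradient \<psi>3 x = gradient \<psi> x /\<^sub>R q x ^ m - (real m * \<psi> x / q x ^ (m + 2)) *\<^sub>R B x"
      unfolding \<psi>3_def by (rule dual.C1_c_div_power(2)[OF \<psi> False])
    define a where "a = A (g x) \<bullet> gradient \<psi> x"
    define b where "b = gradient \<psi> x \<bullet> x"
    define c where "c = g x \<bullet> x"
    define Q where "Q = q x ^ m"
    have Q: "Q > 0"
      using q by (simp add: Q_def)
    have e0: "q x ^ (2 * DIM('a)) = Q * Q * q x ^ 4"
    proof -
      have "2 * DIM('a) = m + m + 4"
        using dim by simp
      then show ?thesis
        by (simp only: Q_def power_add)
    qed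
    have e1: "gradient \<psi>1 x \<bullet> x = b / (Q * (q x)\<^sup>2) - real (m + 2) * \<psi> x * (q x)\<^sup>2 / (Q * q x ^ 4)"
      by (simp add: g1 inner_diff_left q b_def Q_def power_add power2_eq_square divide_inverse mult_ac)
    have e2: "A (g x) \<bullet> gradient \<psi>3 x = a / Q - real m * \<psi> x * c / (Q * (q x)\<^sup>2)"
      by (simp add: g3 inner_diff_right q a_def c_def Q_def A_inner_B power_add power2_eq_square
          divide_inverse mult_ac)
    have e3: "\<psi>1 x = \<psi> x / (Q * (q x)\<^sup>2)"
      by (simp add: \<psi>1_def Q_def power_add power2_eq_square)
    have Bg: "B (gK (S x)) = Q *\<^sub>R ((q x)\<^sup>2 *\<^sub>R g x - (2 * c + real m * u x) *\<^sub>R B x)"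
      by (simp add: gK_inversion[OF False] Q_def c_def inner_commute[of x "g x"])
    have xe: "x \<bullet> B (gK (S x)) = - Q * (q x)\<^sup>2 * (c + real m * u x)"
      by (simp add: Bg inner_diff_right q c_def inner_commute[of x "g x"] algebra_simps)
    have Ae: "gradient \<psi> x \<bullet> gK (S x) = Q * ((q x)\<^sup>2 * a - (2 * c + real m * u x) * b)"
      by (simp add: gK_inversion[OF False] Q_def c_def a_def b_def inner_diff_right inner_commute[of x "g x"]
          inner_commute[of "A (g x)"])
    have e4: "B (gK (S x)) \<bullet> gradient \<phi> (S x) = Q * (q x)\<^sup>2 * ((q x)\<^sup>2 * a + real m * u x * b)"
      using gradient_inversion_inner[OF \<phi> False, of "B (gK (S x))"]
      unfolding \<psi>_def[symmetric] A_B inner_diff_right inner_scaleR_right xe Ae b_def[symmetric]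
      by (simp add: inner_commute algebra_simps)
    show ?thesis
      unfolding e0 unfolding e1 e2 e3 e4 c_def[symmetric] dim
      using q(1) Q by (simp add: field_simps power2_eq_square power_numeral_reduce)
  qed
  \<comment> \<open>The factor \<open>q^(m+4)\<close> from the right-hand side against the Jacobian
    weight \<open>q^(2m+4)\<close> leaves exactly the \<open>1 / q^m\<close> of
    \<open>\<psi>3\<close>; this is what fixes the power of \<open>H\<close> in the dual
    equation.\<close>
  have R: "f (T (S x)) / H (S x) ^ (m + 4) * \<phi> (S x) / q x ^ (2 * DIM('a)) = f x * \<psi>3 x" for x
  proof (cases "x = 0")
    case True
    then show ?thesis
      using zero \<psi>0 by (simp add: inversion_def[of B] \<psi>3_def)
  next
    case False
    have q: "q x > 0"
      using dual.energy_norm_pos[OF False] .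
    have e0: "q x ^ (2 * DIM('a)) = q x ^ (m + 4) * q x ^ m"
    proof -
      have "2 * DIM('a) = (m + 4) + m"
        using dim by simp
      then show ?thesis
        by (simp only: power_add)
    qed
    show ?thesis
      unfolding e0 using q
      by (simp add: dual.energy_norm_inversion power_divide \<psi>3_def \<psi>_def)
  qed
  have int3: "integrable lebesgue (\<lambda>x. A (g x) \<bullet> gradient \<psi>3 x)"
  proof -
    obtain K where K: "compact K" "K \<subseteq> \<Omega>" "\<forall>x. x \<notin> K \<longrightarrow> \<psi>3 x = 0 \<and> gradient \<psi>3 x = 0"
      by (rule C1_c_support[OF C(2)])
    have "continuous_on UNIV (\<lambda>x. A (gradient \<psi>3 x))"
      by (rule linear_continuous_on_compose[OF C1_c_continuous_gradient[OF C(2)] linear_A])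
    then have "integrable lebesgue (\<lambda>x. A (gradient \<psi>3 x) \<bullet> g x)"
      using K by (intro Lp_loc_integrable_bilinear[OF bounded_bilinear_inner u_g_Lp_loc(2)]) auto
    then show ?thesis
      by (simp add: A_sym inner_commute)
  qed
  have "(\<integral>y. B (gK y) \<bullet> gradient \<phi> y \<partial>lebesgue) =
      ?d * (\<integral>x. A (g x) \<bullet> gradient \<psi>3 x + real m * (\<psi>1 x * (g x \<bullet> x))
        + real m * (u x * (gradient \<psi>1 x \<bullet> x + real DIM('a) * \<psi>1 x)) \<partial>lebesgue)"
    using integral_inversion[of "\<lambda>y. B (gK y) \<bullet> gradient \<phi> y"] zero by (simp only: L) simp
  also have "(\<integral>x. A (g x) \<bullet> gradient \<psi>3 x + real m * (\<psi>1 x * (g x \<bullet> x))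
        + real m * (u x * (gradient \<psi>1 x \<bullet> x + real DIM('a) * \<psi>1 x)) \<partial>lebesgue) =
      (\<integral>x. A (g x) \<bullet> gradient \<psi>3 x \<partial>lebesgue) + real m * (\<integral>x. \<psi>1 x * (g x \<bullet> x) \<partial>lebesgue)
        + real m * (\<integral>x. u x * (gradient \<psi>1 x \<bullet> x + real DIM('a) * \<psi>1 x) \<partial>lebesgue)"
    using integrable_test[OF C(1)] int3 by simp
  \<comment> \<open>The two integrals with the factor \<open>m\<close> are opposite by
    \<open>weak_identity_position\<close> for \<open>\<psi>1\<close>.\<close>
  also have "\<dots> = (\<integral>x. f x * \<psi>3 x \<partial>lebesgue)"
    unfolding weak_identity_position[OF C(1)] eq[OF C(2)] by simp
  also have "?d * \<dots> = (\<integral>y. f (T y) / H y ^ (m + 4) * \<phi> y \<partial>lebesgue)"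
    using integral_inversion[of "\<lambda>y. f (T y) / H y ^ (m + 4) * \<phi> y"] zero by (simp only: R mult_zero_right)
  finally show ?thesis .
qed

section \<open>Local integrability of the transform and its gradient\<close>

lemma continuous_factor_measurable:
  fixes c :: "'a \<Rightarrow> real"
  assumes "continuous_on \<Omega> c" "K \<subseteq> \<Omega>" "K \<in> sets lebesgue"
  shows "c \<in> borel_measurable (lebesgue_on K)"
  using assms continuous_imp_measurable_on_sets_lebesgue continuous_on_subset by blast

lemma continuous_on_inverse_power: "continuous_on \<Omega> (\<lambda>x. 1 / H x ^ k)"
  by (intro continuous_intros continuous_on_energy_norm) (use energy_norm_pos in force)

text \<open>Serves both \<open>uK\<close>, with exponent \<open>m\<close>, and the right-hand side
  of the dual equation, with exponent \<open>m + 4\<close>.\<close>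

lemma div_power_inversion_Lp_loc:
  fixes F :: "'a \<Rightarrow> real"
  assumes p: "p > 0" and F: "F \<in> Lp_loc p UNIV"
  shows "(\<lambda>y. F (T y) / H y ^ k) \<in> Lp_loc p \<Omega>"
proof -
  have FT: "(\<lambda>y. F (T y)) \<in> Lp_loc p \<Omega>"
    by (rule inversion_Lp_loc[OF F])
  show ?thesis
  proof (rule Lp_loc_dominated[OF p _ FT FT continuous_on_inverse_power[of k]])
    fix K assume K: "compact K" "K \<subseteq> \<Omega>"
    then have meas: "K \<in> sets lebesgue"
      by (auto intro: fmeasurableD lmeasurable_compact)
    have "(\<lambda>y. F (T y)) \<in> borel_measurable (lebesgue_on K)"
      using FT K by (auto simp: Lp_loc_def Lp_def)
    from borel_measurable_times[OF this continuous_factor_measurable[OF continuous_on_inverse_power K(2) meas]]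
    show "(\<lambda>y. F (T y) / H y ^ k) \<in> borel_measurable (lebesgue_on K)"
      by simp
  next
    fix y assume "y \<in> \<Omega>"
    then have "H y > 0"
      using energy_norm_pos by auto
    then show "norm (F (T y) / H y ^ k) \<le> 1 / H y ^ k * (norm (F (T y)) + norm (F (T y)))"
      by (simp add: abs_mult divide_inverse)
  qed
qed

lemma norm_A_le: "\<exists>a\<ge>0. \<forall>x. norm (A x) \<le> a * norm x"
  using bounded_linear.nonneg_bounded[OF bounded_linear_A] by (metis mult.commute)

lemma gK_measurable:
  assumes K: "K \<in> sets lebesgue" "K \<subseteq> \<Omega>"
    and u: "(\<lambda>y. u (T y)) \<in> borel_measurable (lebesgue_on K)"
    and g: "(\<lambda>y. g (T y)) \<in> borel_measurable (lebesgue_on K)"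
  shows "gK \<in> borel_measurable (lebesgue_on K)"
proof -
  have A: "A \<in> borel_measurable borel"
    by (intro borel_measurable_continuous_onI linear_continuous_on bounded_linear_A)
  have id: "(\<lambda>y. y) \<in> borel_measurable (lebesgue_on K)"
    using K(1) by (intro continuous_imp_measurable_on_sets_lebesgue continuous_on_id)
  have H: "H \<in> borel_measurable (lebesgue_on K)"
    using K(1) by (intro continuous_imp_measurable_on_sets_lebesgue continuous_on_energy_norm)
  note [measurable] = u g H measurable_compose[OF g A] measurable_compose[OF id A]
  show ?thesis
    unfolding gK_def DT_def by measurable
qed

text \<open>The factor comes from estimating the three terms of \<open>gK\<close> separately.
  Continuity off the origin suffices on compact sets; the estimate on unbounded regions is made
  separately in \<open>kelvin_far\<close>.\<close>

lemma gK_bound: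
  obtains c where "continuous_on \<Omega> c"
    "\<And>y. y \<in> \<Omega> \<Longrightarrow> norm (gK y) \<le> c y * (norm (g (T y)) + norm (u (T y)))"
proof -
  obtain a where a: "a \<ge> 0" "\<And>x. norm (A x) \<le> a * norm x"
    using norm_A_le by blast
  define c where "c y = a * (1 / H y ^ (m + 2)) + 2 * (norm (A y))\<^sup>2 * (1 / H y ^ (m + 4))
      + real m * norm (A y) * (1 / H y ^ (m + 2))" for y
  have "continuous_on \<Omega> A"
    by (intro linear_continuous_on bounded_linear_A)
  then have "continuous_on \<Omega> c"
    unfolding c_def by (intro continuous_intros continuous_on_inverse_power)
  moreover have "norm (gK y) \<le> c y * (norm (g (T y)) + norm (u (T y)))" if "y \<in> \<Omega>" for y
  proof -
    have h: "H y > 0"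
      using that energy_norm_pos by auto
    have 1: "norm (A (g (T y)) /\<^sub>R H y ^ (m + 2)) \<le> a * (1 / H y ^ (m + 2)) * norm (g (T y))"
      using a(2)[of "g (T y)"] h by (simp add: divide_simps)
    have 2: "norm ((2 * (A y \<bullet> g (T y)) / H y ^ (m + 4)) *\<^sub>R A y) \<le>
        2 * (norm (A y))\<^sup>2 * (1 / H y ^ (m + 4)) * norm (g (T y))"
      using mult_right_mono[OF Cauchy_Schwarz_ineq2[of "A y" "g (T y)"] norm_ge_zero[of "A y"]] h
      by (simp add: abs_mult divide_simps power2_eq_square mult_ac)
    have 3: "norm ((real m * u (T y) / H y ^ (m + 2)) *\<^sub>R A y) =
        real m * norm (A y) * (1 / H y ^ (m + 2)) * norm (u (T y))"
      using h by (simp add: abs_mult)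
    have "gK y = A (g (T y)) /\<^sub>R H y ^ (m + 2) - (2 * (A y \<bullet> g (T y)) / H y ^ (m + 4)) *\<^sub>R A y
        - (real m * u (T y) / H y ^ (m + 2)) *\<^sub>R A y"
      by (simp add: gK_def DT_def scaleR_diff_right power_add divide_inverse power2_eq_square mult_ac)
    also have "norm \<dots> \<le> norm (A (g (T y)) /\<^sub>R H y ^ (m + 2))
        + norm ((2 * (A y \<bullet> g (T y)) / H y ^ (m + 4)) *\<^sub>R A y)
        + norm ((real m * u (T y) / H y ^ (m + 2)) *\<^sub>R A y)"
      by (meson add_mono norm_triangle_ineq4 order_refl order_trans)
    also have "\<dots> \<le> (a * (1 / H y ^ (m + 2)) + 2 * (norm (A y))\<^sup>2 * (1 / H y ^ (m + 4))) * norm (g (T y))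
        + real m * norm (A y) * (1 / H y ^ (m + 2)) * norm (u (T y))"
      using 1 2 3 by (simp add: distrib_right)
    also have "\<dots> \<le> c y * norm (g (T y)) + c y * norm (u (T y))"
      using a h by (intro add_mono mult_right_mono) (simp_all add: c_def)
    finally show ?thesis
      by (simp add: distrib_left)
  qed
  ultimately show thesis
    by (rule that)
qed

lemma gK_Lp_loc:
  assumes p: "p > 0" and u: "u \<in> Lp_loc p UNIV" and g: "g \<in> Lp_loc p UNIV"
  shows "gK \<in> Lp_loc p \<Omega>"
proof -
  obtain c where c: "continuous_on \<Omega> c"
    "\<And>y. y \<in> \<Omega> \<Longrightarrow> norm (gK y) \<le> c y * (norm (g (T y)) + norm (u (T y)))"
    using gK_bound by blast
  have uT: "(\<lambda>y. u (T y)) \<in> Lp_loc p \<Omega>" and gT: "(\<lambda>y. g (T y)) \<in> Lp_loc p \<Omega>"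
    using u g by (auto intro: inversion_Lp_loc)
  show ?thesis
  proof (rule Lp_loc_dominated[OF p _ gT uT c])
    fix K assume K: "compact K" "K \<subseteq> \<Omega>"
    then have "K \<in> sets lebesgue"
      by (auto intro: fmeasurableD lmeasurable_compact)
    moreover have "(\<lambda>y. u (T y)) \<in> borel_measurable (lebesgue_on K)"
      "(\<lambda>y. g (T y)) \<in> borel_measurable (lebesgue_on K)"
      using uT gT K by (auto simp: Lp_loc_def Lp_def)
    ultimately show "gK \<in> borel_measurable (lebesgue_on K)"
      using K(2) by (intro gK_measurable)
  qed
qed

lemma kelvin_has_weak_gradient: "has_weak_gradient \<Omega> uK gK"
proof -
  have "u \<in> Lp_loc 1 UNIV" "g \<in> Lp_loc 1 UNIV"
    using weak by (simp_all add: has_weak_gradient_iff)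
  then have "uK \<in> Lp_loc 1 \<Omega>" "gK \<in> Lp_loc 1 \<Omega>"
    unfolding uK_def by (auto intro: div_power_inversion_Lp_loc gK_Lp_loc)
  then show ?thesis
    using kelvin_weak_gradient_identity by (simp add: has_weak_gradient_iff)
qed

end

section \<open>Integrability far from the origin\<close>

text \<open>Up to a constant the terms are \<open>2^((2-n)k)\<close>: the square of the inverse
  radius gains a factor 4 per step, while the volume loses \<open>2^n\<close>. Replacing
  \<open>n\<close> by 3 leaves a geometric series.\<close>

lemma summable_dyadic_volumes:
  fixes c :: real and n :: nat
  assumes n: "n \<ge> 3"
  shows "summable (\<lambda>k. 4 ^ Suc k * c * (1 / 2 ^ k) ^ n)"
proof (rule summable_comparison_test)
  show "summable (\<lambda>k. 4 * \<bar>c\<bar> * (1 / 2) ^ k :: real)"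
    by (intro summable_mult summable_geometric) simp
  have "norm (4 ^ Suc k * c * (1 / 2 ^ k) ^ n) \<le> 4 * \<bar>c\<bar> * (1 / 2) ^ k" for k
  proof -
    have "(1 / 2 ^ k) ^ n \<le> (1 / 2 ^ k :: real) ^ 3"
      using n by (intro power_decreasing) auto
    then have "4 ^ k * (1 / 2 ^ k) ^ n \<le> 4 ^ k * (1 / 2 ^ k :: real) ^ 3"
      by simp
    also have "\<dots> = (1 / 2) ^ k"
    proof -
      have "(4 :: real) ^ k = 2 ^ k * 2 ^ k"
        by (simp flip: power_mult_distrib)
      then show ?thesis
        by (simp add: power3_eq_cube power_divide)
    qed
    finally have "4 * \<bar>c\<bar> * (4 ^ k * (1 / 2 ^ k) ^ n) \<le> 4 * \<bar>c\<bar> * (1 / 2) ^ k"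
      by (intro mult_left_mono) auto
    then show ?thesis
      by (simp add: abs_mult mult_ac)
  qed
  then show "\<exists>N. \<forall>k\<ge>N. norm (4 ^ Suc k * c * (1 / 2 ^ k) ^ n) \<le> 4 * \<bar>c\<bar> * (1 / 2) ^ k"
    by blast
qed

lemma dyadic_shell:
  fixes r t :: real
  assumes "0 < t" "t \<le> r"
  obtains k where "t \<le> r / 2 ^ k" "r / 2 ^ Suc k < t"
proof -
  have "\<exists>k. r / 2 ^ Suc k < t"
  proof -
    obtain k where "r / t < 2 ^ k"
      using real_arch_pow[of 2 "r / t"] by auto
    also have "(2 :: real) ^ k \<le> 2 ^ Suc k"
      by simp
    finally show ?thesis
      using assms(1) by (auto simp: field_simps intro: exI[of _ k])
  qed
  then have least: "r / 2 ^ Suc (LEAST k. r / 2 ^ Suc k < t) < t"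
    by (rule LeastI_ex)
  show thesis
  proof (rule that[OF _ least])
    show "t \<le> r / 2 ^ (LEAST k. r / 2 ^ Suc k < t)"
    \<comment> \<open>For index 0 the claim is \<open>t \<le> r\<close>; otherwise the preceding
      index violates the inequality that defines the least one.\<close>
    proof (cases "LEAST k. r / 2 ^ Suc k < t")
      case 0
      then show ?thesis
        using assms by simp
    next
      case (Suc j)
      then have "\<not> r / 2 ^ Suc j < t"
        by (metis lessI not_less_Least)
      with Suc show ?thesis
        by simp
    qed
  qed
qed

text \<open>On each dyadic shell the integrand is bounded by its value at the inner radius. That
  bound is spread over the whole ball containing the shell; despite the overlaps the volumes of the
  balls keep the sum finite.\<close>

lemma set_integrable_inverse_norm_power2:
  fixes r :: real
  assumes dim: "DIM('a::euclidean_space) \<ge> 3"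
  shows "set_integrable lebesgue (cball 0 r) (\<lambda>x :: 'a. 1 / (norm x)\<^sup>2)"
proof (cases "r > 0")
  case False
  \<comment> \<open>At the origin the integrand is 0 by the convention for division.\<close>
  then have "cball (0 :: 'a) r \<subseteq> {0}"
    by (metis cball_eq_empty cball_trivial empty_subsetI linorder_neqE_linordered_idom order_refl)
  then have "(\<lambda>x :: 'a. indicator (cball 0 r) x *\<^sub>R (1 / (norm x)\<^sup>2)) = (\<lambda>x. 0)"
    by (auto simp: fun_eq_iff indicator_def)
  then show ?thesis
    by (simp add: set_integrable_def)
next
  case True
  define V where "V = measure lborel (ball (0 :: 'a) 1)"
  have V: "V \<ge> 0"
    by (simp add: V_def)
  let ?F = "\<lambda>x :: 'a. indicator (cball 0 r) x *\<^sub>R (1 / (norm x)\<^sup>2)"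
  let ?C = "\<lambda>k. cball (0 :: 'a) (r / 2 ^ k)"
  have term_le: "h k \<le> (\<Sum>k. h k)" for h :: "nat \<Rightarrow> ennreal" and k
    using sum_le_suminf[of h "{k}"] by simp
  have vol: "emeasure lebesgue (?C k) = ennreal ((r / 2 ^ k) ^ DIM('a) * V)" for k
  proof -
    have "emeasure lebesgue (?C k) = ennreal (measure lborel (?C k))"
      using emeasure_lborel_cball_finite[of "0 :: 'a" "r / 2 ^ k"]
      by (simp add: emeasure_eq_ennreal_measure)
    then show ?thesis
      using True content_ball_conv_unit_ball[of "r / 2 ^ k" "0 :: 'a"]
      by (simp add: content_cball_conv_ball V_def)
  qed
  have "(\<integral>\<^sup>+x. ennreal (norm (?F x)) \<partial>lebesgue) \<le>
      (\<integral>\<^sup>+x. (\<Sum>k. ennreal (4 ^ Suc k / r\<^sup>2) * indicator (?C k) x) \<partial>lebesgue)"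
  proof (rule nn_integral_mono)
    fix x :: 'a
    show "ennreal (norm (?F x)) \<le> (\<Sum>k. ennreal (4 ^ Suc k / r\<^sup>2) * indicator (?C k) x)"
    proof (cases "x \<noteq> 0 \<and> norm x \<le> r")
      case True
      then obtain k where k: "norm x \<le> r / 2 ^ k" "r / 2 ^ Suc k < norm x"
        using dyadic_shell[of "norm x" r] by auto
      have "(r / 2 ^ Suc k)\<^sup>2 \<le> (norm x)\<^sup>2"
        using k \<open>r > 0\<close> by (intro power_mono) auto
      then have "1 / (norm x)\<^sup>2 \<le> 1 / (r / 2 ^ Suc k)\<^sup>2"
        using \<open>r > 0\<close> True by (intro divide_left_mono) auto
      also have "\<dots> = 4 ^ Suc k / r\<^sup>2"
      proof -
        have "((2 :: real) ^ Suc k)\<^sup>2 = 4 ^ Suc k"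
          by (simp add: power2_eq_square flip: power_mult_distrib)
        then show ?thesis
          by (simp only: power_divide) simp
      qed
      finally have "ennreal (norm (?F x)) \<le> ennreal (4 ^ Suc k / r\<^sup>2) * indicator (?C k) x"
        using True k by (simp add: indicator_def ennreal_leI)
      also have "\<dots> \<le> (\<Sum>k. ennreal (4 ^ Suc k / r\<^sup>2) * indicator (?C k) x)"
        by (rule term_le)
      finally show ?thesis .
    next
      case False
      then have "ennreal (norm (?F x)) = 0"
        by (auto simp: indicator_def)
      then show ?thesis
        by (simp only: zero_le)
    qed
  qed
  also have "\<dots> = (\<Sum>k. \<integral>\<^sup>+x. ennreal (4 ^ Suc k / r\<^sup>2) * indicator (?C k) x \<partial>lebesgue)"
    by (rule nn_integral_suminf)
      (intro borel_measurable_times_ennreal borel_measurable_const borel_measurable_indicator,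
        simp add: lmeasurable_cball fmeasurableD)
  also have "\<dots> = (\<Sum>k. ennreal (4 ^ Suc k * (r ^ DIM('a) * V / r\<^sup>2) * (1 / 2 ^ k) ^ DIM('a)))"
  proof (rule suminf_cong)
    fix k
    have "(\<integral>\<^sup>+x. ennreal (4 ^ Suc k / r\<^sup>2) * indicator (?C k) x \<partial>lebesgue) =
        ennreal (4 ^ Suc k / r\<^sup>2) * ennreal ((r / 2 ^ k) ^ DIM('a) * V)"
      by (subst nn_integral_cmult_indicator) (simp_all add: vol)
    also have "\<dots> = ennreal (4 ^ Suc k / r\<^sup>2 * ((r / 2 ^ k) ^ DIM('a) * V))"
      using V True by (intro ennreal_mult[symmetric]) auto
    also have "4 ^ Suc k / r\<^sup>2 * ((r / 2 ^ k) ^ DIM('a) * V) =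
        4 ^ Suc k * (r ^ DIM('a) * V / r\<^sup>2) * (1 / 2 ^ k) ^ DIM('a)"
      by (simp add: power_divide)
    finally show "(\<integral>\<^sup>+x. ennreal (4 ^ Suc k / r\<^sup>2) * indicator (?C k) x \<partial>lebesgue) =
        ennreal (4 ^ Suc k * (r ^ DIM('a) * V / r\<^sup>2) * (1 / 2 ^ k) ^ DIM('a))" .
  qed
  also have "\<dots> < \<infinity>"
  proof -
    have "(\<Sum>k. ennreal (4 ^ Suc k * (r ^ DIM('a) * V / r\<^sup>2) * (1 / 2 ^ k) ^ DIM('a))) \<noteq> top"
      by (rule ennreal_suminf_neq_top[OF summable_dyadic_volumes[OF dim]]) (use V True in simp)
    then show ?thesis
      by (simp add: less_top[symmetric])
  qed
  finally have "(\<integral>\<^sup>+x. ennreal (norm (?F x)) \<partial>lebesgue) < \<infinity>" .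
  moreover have "?F \<in> borel_measurable lebesgue"
  proof -
    have "?F \<in> borel_measurable borel"
      by (intro borel_measurable_scaleR borel_measurable_indicator borel_measurable_divide
          borel_measurable_const borel_measurable_power borel_measurable_norm) auto
    then show ?thesis
      by (simp add: measurable_completion)
  qed
  ultimately show ?thesis
    by (simp add: set_integrable_def integrable_iff_bounded)
qed

section \<open>Comparison of norms and domination after the inversion\<close>

context dual_forms
begin

text \<open>Duality replaces a compactness argument: \<open>Cauchy_Schwarz\<close> bounds the
  squared Euclidean norm by \<open>H x * q x\<close>, and boundedness of \<open>B\<close> bounds
  \<open>q x\<close> by a multiple of \<open>norm x\<close>, which is then cancelled.\<close>

lemma norm_le_energy_norm: "\<exists>c>0. \<forall>x. norm x \<le> c * H x"
proof -
  obtain a where a: "a > 0" "\<And>x. norm (B x) \<le> norm x * a"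
    using bounded_linear.pos_bounded[OF dual.bounded_linear_A] by auto
  have "norm x \<le> sqrt a * H x" for x
  proof (cases "x = 0")
    case False
    have "(q x)\<^sup>2 \<le> norm (B x) * norm x"
      unfolding dual.energy_norm_power2 by (rule norm_cauchy_schwarz)
    also have "\<dots> \<le> a * (norm x)\<^sup>2"
      using mult_right_mono[OF a(2)[of x] norm_ge_zero[of x]] by (simp add: power2_eq_square mult_ac)
    also have "\<dots> = (sqrt a * norm x)\<^sup>2"
      using a by (simp add: power_mult_distrib)
    finally have q: "q x \<le> sqrt a * norm x"
      by (rule power2_le_imp_le) (use a in simp)
    have "norm x * norm x = \<bar>x \<bullet> x\<bar>"
      by (simp add: dot_square_norm power2_eq_square)
    also have "\<dots> \<le> H x * q x"
      by (rule Cauchy_Schwarz)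
    also have "\<dots> \<le> H x * (sqrt a * norm x)"
      using q energy_norm_pos[OF False] by (intro mult_left_mono) auto
    finally show ?thesis
      using False by (simp add: mult_ac)
  qed (simp add: energy_norm_def)
  moreover have "sqrt a > 0"
    using a by simp
  ultimately show ?thesis
    by blast
qed

end

context dual_forms
begin

text \<open>By \<open>energy_norm_inversion\<close>, a lower bound on \<open>H y\<close> is an upper
  bound on \<open>q (T y)\<close>; both norms are comparable with the Euclidean one.\<close>

lemma inversion_far_bounded:
  assumes "R > 0"
  obtains r where "T ` {y. norm y > R} \<subseteq> cball 0 r"
proof -
  obtain c where c: "c > 0" "\<And>x. norm x \<le> c * H x"
    using norm_le_energy_norm by blast
  obtain d where d: "d > 0" "\<And>x. norm x \<le> d * q x"
    using dual.norm_le_energy_norm by blast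
  have "norm (T y) \<le> d * c / R" if y: "norm y > R" for y
  proof -
    have "R \<le> c * H y"
      using c(2)[of y] y by linarith
    moreover have "H y > 0"
      using energy_norm_pos[of y] y assms by fastforce
    ultimately have "1 / H y \<le> c / R"
      using assms by (simp add: field_simps)
    then have "d * (1 / H y) \<le> d * (c / R)"
      using d(1) by (intro mult_left_mono) auto
    then show ?thesis
      using d(2)[of "T y"] by (simp add: energy_norm_inversion)
  qed
  then have "T ` {y. norm y > R} \<subseteq> cball 0 (d * c / R)"
    by auto
  then show thesis
    by (rule that)
qed

text \<open>The domination is required in the variable x = T y, where it may fail on a null set. An
  almost everywhere bound on \<open>u\<close> can thus be used directly, without transporting null
  sets.\<close>

lemma Lp_by_inversion:
  fixes v :: "'a \<Rightarrow> 'b::euclidean_space"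
  assumes X: "X \<in> sets lebesgue" "X \<subseteq> \<Omega>"
    and v: "v \<in> borel_measurable (lebesgue_on X)"
    and w: "set_integrable lebesgue (T ` X) w"
    and le: "AE x in lebesgue. x \<in> T ` X \<longrightarrow> norm (v (S x)) powr p / q x ^ (2 * DIM('a)) \<le> w x"
  shows "v \<in> Lp p X"
proof -
  have TX: "T ` X \<in> sets lebesgue" "T ` X \<subseteq> \<Omega>"
    using X inversion_image_lebesgue by auto
  have vS: "(\<lambda>x. v (S x)) \<in> borel_measurable (lebesgue_on (T ` X))"
    using dual.inversion_measurable[OF TX X(1) _ v] by (simp add: inversion_image_inverse)
  have qm: "q \<in> borel_measurable (lebesgue_on (T ` X))"
    using TX(1) by (intro continuous_imp_measurable_on_sets_lebesgue dual.continuous_on_energy_norm)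
  note [measurable] = vS qm
  have "(\<lambda>x. norm (v (S x)) powr p / q x ^ (2 * DIM('a))) \<in> borel_measurable (lebesgue_on (T ` X))"
    by measurable
  then have "set_borel_measurable lebesgue (T ` X) (\<lambda>x. norm (v (S x)) powr p / q x ^ (2 * DIM('a)))"
    using TX(1) by (simp add: set_borel_measurable_def borel_measurable_restrict_space_iff)
  moreover have "AE x in lebesgue. x \<in> T ` X \<longrightarrow>
      norm (norm (v (S x)) powr p / q x ^ (2 * DIM('a))) \<le> norm (w x)"
    using le
  proof eventually_elim
    case (elim x)
    have "0 \<le> q x"
      by (cases "x = 0") (auto simp: energy_norm_def intro!: less_imp_le dual.A_pos)
    then show ?case
      using elim by auto
  qed
  ultimately have "set_integrable lebesgue (T ` X) (\<lambda>x. norm (v (S x)) powr p / q x ^ (2 * DIM('a)))"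
    by (rule set_integrable_bound[OF w])
  then have "set_integrable lebesgue X (\<lambda>y. norm (v y) powr p)"
    using set_integrable_inversion(1)[OF X, of "\<lambda>y. norm (v y) powr p"] by simp
  then show ?thesis
    using v by (simp add: Lp_def)
qed

end

context dual_forms
begin

lemma far_region: "R > 0 \<Longrightarrow> {y. norm y > R} \<subseteq> \<Omega>" "{y :: 'a. norm y > R} \<in> sets lebesgue"
proof -
  show "R > 0 \<Longrightarrow> {y. norm y > R} \<subseteq> \<Omega>"
    by auto
  have "open {y :: 'a. norm y > R}"
    by (intro open_Collect_less continuous_intros)
  then show "{y :: 'a. norm y > R} \<in> sets lebesgue"
    by simp
qed

end

section \<open>Estimates far from the origin and the two conclusions\<close>

context kelvin
begin

text \<open>In the variable x = T y the powers of \<open>q\<close> in \<open>uK\<close> and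
  \<open>gK\<close>, raised to the respective exponent, cancel the Jacobian weight. What remains is
  an estimate of \<open>u\<close> and \<open>g\<close> on a fixed ball.\<close>

lemma kelvin_far:
  assumes R: "R > 0" and u: "u \<in> Lp_loc 2 UNIV" and g: "g \<in> Lp_loc 2 UNIV"
    and bdd: "locally_bounded UNIV u"
  shows "gK \<in> Lp 2 {y. norm y > R}"
    and "m \<ge> 1 \<Longrightarrow> uK \<in> Lp (2 * real DIM('a) / (real DIM('a) - 2)) {y. norm y > R}"
proof -
  let ?X = "{y :: 'a. norm y > R}"
  note X = far_region(2)[of R] far_region(1)[OF R]
  obtain r where r: "T ` ?X \<subseteq> cball 0 r"
    using inversion_far_bounded[OF R] by blast
  have TX: "T ` ?X \<in> sets lebesgue" "T ` ?X \<subseteq> \<Omega>"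
    using X inversion_image_lebesgue by auto
  have ball: "cball (0 :: 'a) r \<in> sets lebesgue"
    by simp
  have u2: "u \<in> Lp 2 (cball 0 r)" and g2: "g \<in> Lp 2 (cball 0 r)"
    using u g by (auto simp: Lp_loc_def)
  then have "u \<in> borel_measurable (lebesgue_on (cball 0 r))" "g \<in> borel_measurable (lebesgue_on (cball 0 r))"
    by (simp_all add: Lp_def)
  then have um: "(\<lambda>y. u (T y)) \<in> borel_measurable (lebesgue_on ?X)"
    and gm: "(\<lambda>y. g (T y)) \<in> borel_measurable (lebesgue_on ?X)"
    using inversion_measurable[OF X ball r] by auto
  \<comment> \<open>No sign of \<open>U\<close> is recorded, so the bounds below use its absolute
    value.\<close>
  obtain U where U: "AE x in lebesgue. x \<in> cball 0 r \<longrightarrow> \<bar>u x\<bar> \<le> U"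
    using bdd unfolding locally_bounded_def by (meson compact_cball subset_UNIV)
  have T0: "x \<noteq> 0" if "x \<in> T ` ?X" for x
    using that TX(2) by blast
  have e0: "q x ^ (2 * DIM('a)) = (q x ^ (m + 2))\<^sup>2" for x
    unfolding dim power_mult[symmetric] by (simp only: mult.commute)
  show "gK \<in> Lp 2 ?X"
  proof -
    obtain a where a: "a \<ge> 0" "\<And>x. norm (A x) \<le> a * norm x"
      using norm_A_le by blast
    obtain d where d: "d > 0" "\<And>x. norm x \<le> d * q x"
      using dual.norm_le_energy_norm by blast
    \<comment> \<open>\<open>D\<close> collects the terms of \<open>gK_inversion\<close> that are
      linear in \<open>g\<close>, with \<open>norm x\<close> bounded by \<open>d * q x\<close>;
      \<open>E\<close> is the coefficient left by the term in \<open>u\<close>.\<close>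
    define D where "D = a + 2 * d\<^sup>2"
    define E where "E = real m * d\<^sup>2 * \<bar>U\<bar>"
    define w where "w x = 2 * D\<^sup>2 * (norm (g x))\<^sup>2 + 2 * E\<^sup>2 * (1 / (norm x)\<^sup>2)" for x :: 'a
    have "set_integrable lebesgue (cball 0 r) (\<lambda>x. (norm (g x))\<^sup>2)"
      using g2 by (simp add: Lp_def powr_numeral)
    then have i1: "set_integrable lebesgue (cball 0 r) (\<lambda>x. 2 * D\<^sup>2 * (norm (g x))\<^sup>2)"
      by (rule set_integrable_mult_right)
    have i2: "set_integrable lebesgue (cball 0 r) (\<lambda>x :: 'a. 2 * E\<^sup>2 * (1 / (norm x)\<^sup>2))"
    proof (cases "m = 0")
      case True
      then show ?thesis
        by (simp add: E_def set_integrable_def)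
    next
      case False
      then have "DIM('a) \<ge> 3"
        using dim by simp
      then show ?thesis
        by (intro set_integrable_mult_right set_integrable_inverse_norm_power2)
    qed
    have "set_integrable lebesgue (cball 0 r) w"
      unfolding w_def by (rule set_integral_add(1)[OF i1 i2])
    then have wint: "set_integrable lebesgue (T ` ?X) w"
      using TX(1) r by (rule set_integrable_subset)
    have "AE x in lebesgue. x \<in> T ` ?X \<longrightarrow> norm (gK (S x)) powr 2 / q x ^ (2 * DIM('a)) \<le> w x"
      using U
    proof eventually_elim
      case (elim x)
      show ?case
      proof
        assume x: "x \<in> T ` ?X"
        then have x0: "x \<noteq> 0" and ux: "\<bar>u x\<bar> \<le> \<bar>U\<bar>"
          using T0 elim r by auto
        have q: "q x > 0"
          using dual.energy_norm_pos[OF x0] .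
        have nx: "norm x > 0" "norm x \<le> d * q x"
          using x0 d by auto
        have gK: "norm (gK (S x)) = q x ^ m * norm ((q x)\<^sup>2 *\<^sub>R A (g x) - (2 * (x \<bullet> g x) + real m * u x) *\<^sub>R x)"
          using q by (simp add: gK_inversion[OF x0])
        have "norm ((q x)\<^sup>2 *\<^sub>R A (g x) - (2 * (x \<bullet> g x) + real m * u x) *\<^sub>R x) \<le>
            (q x)\<^sup>2 * norm (A (g x)) + (2 * \<bar>x \<bullet> g x\<bar> + real m * \<bar>u x\<bar>) * norm x"
        proof -
          have "norm ((2 * (x \<bullet> g x) + real m * u x) *\<^sub>R x) \<le> (2 * \<bar>x \<bullet> g x\<bar> + real m * \<bar>u x\<bar>) * norm x"
            using abs_triangle_ineq[of "2 * (x \<bullet> g x)" "real m * u x"]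
            by (simp add: abs_mult mult_right_mono)
          moreover have "norm ((q x)\<^sup>2 *\<^sub>R A (g x)) = (q x)\<^sup>2 * norm (A (g x))"
            by simp
          ultimately show ?thesis
            by (smt (verit) norm_triangle_ineq4)
        qed
        also have "\<dots> \<le> (q x)\<^sup>2 * (a * norm (g x)) + (2 * (norm x * norm (g x)) + real m * \<bar>U\<bar>) * norm x"
          using Cauchy_Schwarz_ineq2[of x "g x"] ux a(2)[of "g x"]
          by (intro add_mono mult_mono mult_left_mono) auto
        \<comment> \<open>One factor \<open>norm x\<close> is written as its square over itself, so
          that a square of \<open>q x\<close> can be extracted from every term; this is the source
          of the weight \<open>1 / norm x\<close>.\<close>
        also have "\<dots> = (q x)\<^sup>2 * (a * norm (g x)) + 2 * (norm x)\<^sup>2 * norm (g x)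
            + real m * \<bar>U\<bar> * (norm x)\<^sup>2 * (1 / norm x)"
          using nx(1) by (simp add: power2_eq_square algebra_simps)
        also have "\<dots> \<le> (q x)\<^sup>2 * (a * norm (g x)) + 2 * (d * q x)\<^sup>2 * norm (g x)
            + real m * \<bar>U\<bar> * (d * q x)\<^sup>2 * (1 / norm x)"
          using nx power_mono[of "norm x" "d * q x" 2]
          by (intro add_mono mult_right_mono mult_left_mono) auto
        also have "\<dots> = (q x)\<^sup>2 * (D * norm (g x) + E * (1 / norm x))"
          by (simp add: D_def E_def power_mult_distrib algebra_simps)
        finally have "norm (gK (S x)) \<le> q x ^ m * ((q x)\<^sup>2 * (D * norm (g x) + E * (1 / norm x)))"
          unfolding gK using q by (intro mult_left_mono) auto
        then have "norm (gK (S x)) \<le> q x ^ (m + 2) * (D * norm (g x) + E * (1 / norm x))"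
          by (simp only: power_add mult.assoc)
        then have "(norm (gK (S x)))\<^sup>2 \<le> (q x ^ (m + 2) * (D * norm (g x) + E * (1 / norm x)))\<^sup>2"
          by (rule power_mono) simp
        then have "(norm (gK (S x)))\<^sup>2 / q x ^ (2 * DIM('a)) \<le> (D * norm (g x) + E * (1 / norm x))\<^sup>2"
          unfolding e0 using q by (simp add: power_mult_distrib divide_le_eq mult.commute)
        also have "\<dots> \<le> 2 * (D * norm (g x))\<^sup>2 + 2 * (E * (1 / norm x))\<^sup>2"
          using sum_squares_bound[of "D * norm (g x)" "E * (1 / norm x)"]
          by (simp only: power2_sum)
        also have "\<dots> = w x"
          by (simp add: w_def power_mult_distrib power_divide)
        finally show "norm (gK (S x)) powr 2 / q x ^ (2 * DIM('a)) \<le> w x"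
          by (simp add: powr_numeral)
      qed
    qed
    with wint show ?thesis
      using Lp_by_inversion[OF X gK_measurable[OF X um gm]] by blast
  qed
  assume m: "m \<ge> 1"
  define p where "p = 2 * real DIM('a) / (real DIM('a) - 2)"
  have p: "p = 2 * (real m + 2) / real m" "p > 0"
    using m by (simp_all add: p_def dim)
  have "uK \<in> Lp p ?X"
  proof (rule Lp_by_inversion[OF X])
    have "H \<in> borel_measurable (lebesgue_on ?X)"
      using X(1) by (intro continuous_imp_measurable_on_sets_lebesgue continuous_on_energy_norm)
    note [measurable] = this um
    show "uK \<in> borel_measurable (lebesgue_on ?X)"
      unfolding uK_def by measurable
    have "set_integrable lebesgue (cball (0 :: 'a) r) (\<lambda>x. \<bar>U\<bar> powr p)"
      using emeasure_lborel_cball_finite[of "0 :: 'a" r] by (simp add: set_integrable_def)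
    then show "set_integrable lebesgue (T ` ?X) (\<lambda>x. \<bar>U\<bar> powr p)"
      using TX(1) r by (rule set_integrable_subset)
    show "AE x in lebesgue. x \<in> T ` ?X \<longrightarrow> norm (uK (S x)) powr p / q x ^ (2 * DIM('a)) \<le> \<bar>U\<bar> powr p"
      using U
    proof eventually_elim
      case (elim x)
      show ?case
      proof
        assume x: "x \<in> T ` ?X"
        then have x0: "x \<noteq> 0" and ux: "\<bar>u x\<bar> \<le> \<bar>U\<bar>"
          using T0 elim r by auto
        have q: "q x > 0"
          using dual.energy_norm_pos[OF x0] .
        \<comment> \<open>The exponent is critical: \<open>m * p\<close> is twice the dimension, so
          the Kelvin weight cancels the Jacobian and only the bounded \<open>u\<close> is
          left.\<close>
        have "(q x ^ m) powr p = q x powr (real m * p)"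
          using q by (simp add: powr_powr flip: powr_realpow)
        also have "real m * p = real (2 * DIM('a))"
          using m by (simp add: p(1) dim)
        also have "q x powr real (2 * DIM('a)) = q x ^ (2 * DIM('a))"
          using q by (rule powr_realpow)
        finally have "(q x ^ m) powr p = q x ^ (2 * DIM('a))" .
        then have "norm (uK (S x)) powr p / q x ^ (2 * DIM('a)) = \<bar>u x\<bar> powr p"
          using q by (simp add: uK_inversion[OF x0] abs_mult powr_mult)
        also have "\<dots> \<le> \<bar>U\<bar> powr p"
          using ux p(2) by (intro powr_mono2) auto
        finally show "norm (uK (S x)) powr p / q x ^ (2 * DIM('a)) \<le> \<bar>U\<bar> powr p" .
      qed
    qed
  qed
  then show "uK \<in> Lp (2 * real DIM('a) / (real DIM('a) - 2)) ?X"
    by (simp add: p_def)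
qed

lemma kelvin_transform_eq: "kelvin_transform H u = uK"
  by (simp add: fun_eq_iff kelvin_transform_def uK_def dim T_map_energy_norm)

theorem kelvin_D12_far_from_origin:
  assumes "u \<in> Lp_loc 2 UNIV" "g \<in> Lp_loc 2 UNIV" "locally_bounded UNIV u"
  shows "D12_far_from_origin uK"
  unfolding D12_far_from_origin_def
proof (intro allI impI conjI)
  fix R :: real assume R: "R > 0"
  have "has_weak_gradient {y. norm y > R} uK gK"
    by (rule has_weak_gradient_subset[OF kelvin_has_weak_gradient far_region(1)[OF R]])
  then show "\<exists>g. has_weak_gradient {y. norm y > R} uK g \<and> g \<in> Lp 2 {y. norm y > R}"
    using kelvin_far(1)[OF R assms] by blast
  assume "DIM('a) \<ge> 3"
  then show "uK \<in> Lp (2 * real DIM('a) / (real DIM('a) - 2)) {y. norm y > R}"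
    using dim by (intro kelvin_far(2)[OF R assms]) simp
qed

theorem kelvin_weak_solution:
  assumes u: "u \<in> Lp_loc 2 UNIV" and g: "g \<in> Lp_loc 2 UNIV" and f: "f \<in> Lp_loc 2 UNIV"
    and eq: "\<And>\<psi>. \<psi> \<in> C1_c UNIV \<Longrightarrow>
      (LINT x:UNIV|lebesgue. finsler_field H (g x) \<bullet> gradient \<psi> x) = (LINT x:UNIV|lebesgue. f x * \<psi> x)"
  shows "weak_solution (dual_norm H) \<Omega> (\<lambda>y. f (T_map H y) / H y ^ (DIM('a) + 2)) uK"
proof -
  have uK: "uK \<in> Lp_loc 2 \<Omega>"
    unfolding uK_def by (rule div_power_inversion_Lp_loc[OF _ u]) simp
  have gK: "gK \<in> Lp_loc 2 \<Omega>"
    by (rule gK_Lp_loc[OF _ u g]) simp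
  have fK: "(\<lambda>y. f (T y) / H y ^ (DIM('a) + 2)) \<in> Lp_loc 2 \<Omega>"
    by (rule div_power_inversion_Lp_loc[OF _ f]) simp
  have eq': "(\<integral>x. A (g x) \<bullet> gradient \<psi> x \<partial>lebesgue) = (\<integral>x. f x * \<psi> x \<partial>lebesgue)"
    if "\<psi> \<in> C1_c \<Omega>" for \<psi>
    using eq[OF C1_c_mono[OF that]] by (simp add: finsler_field_energy_norm set_lebesgue_integral_def)
  have "(LINT y:\<Omega>|lebesgue. finsler_field (dual_norm H) (gK y) \<bullet> gradient \<phi> y) =
      (LINT y:\<Omega>|lebesgue. f (T y) / H y ^ (DIM('a) + 2) * \<phi> y)" if \<phi>: "\<phi> \<in> C1_c \<Omega>" for \<phi>
  proof -
    have "(LINT y:\<Omega>|lebesgue. B (gK y) \<bullet> gradient \<phi> y) = (\<integral>y. B (gK y) \<bullet> gradient \<phi> y \<partial>lebesgue)"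
      by (rule set_lebesgue_integral_supported) (simp add: C1_c_zero[OF \<phi>])
    also have "\<dots> = (\<integral>y. f (T y) / H y ^ (DIM('a) + 2) * \<phi> y \<partial>lebesgue)"
    proof -
      have "DIM('a) + 2 = m + 4"
        using dim by simp
      then show ?thesis
        using kelvin_weak_equation[OF eq' \<phi>] by (simp only:)
    qed
    also have "\<dots> = (LINT y:\<Omega>|lebesgue. f (T y) / H y ^ (DIM('a) + 2) * \<phi> y)"
      by (rule set_lebesgue_integral_supported[symmetric]) (simp add: C1_c_zero[OF \<phi>])
    finally show ?thesis
      by (simp only: dual_norm_energy_norm dual.finsler_field_energy_norm)
  qed
  then show ?thesis
    using uK gK fK kelvin_has_weak_gradient
    unfolding weak_solution_def H1_loc_def T_map_energy_norm by blast
qed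

end

section \<open>Positive definite matrices and the final statement\<close>

lemma symmetric_positive_definite_dual_forms:
  fixes M :: "real ^ 'n ^ 'n"
  assumes sym: "transpose M = M" and pos: "\<And>x. x \<noteq> 0 \<Longrightarrow> (M *v x) \<bullet> x > 0"
  obtains B where "dual_forms ((*v) M) B"
proof -
  have "\<exists>M'. M' ** M = mat 1"
    unfolding matrix_left_invertible_ker using pos by fastforce
  then obtain M' where M': "M' ** M = mat 1" "M ** M' = mat 1"
    using matrix_left_right_inverse by blast
  have "dual_forms ((*v) M) ((*v) M')"
  proof (rule dual_forms.intro)
    show "linear ((*v) M)"
      by simp
    show "(M *v x) \<bullet> y = x \<bullet> (M *v y)" for x y
      by (metis dot_lmul_matrix sym vector_transpose_matrix)
    show "M *v (M' *v x) = x" "M' *v (M *v x) = x" for x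
      by (simp_all add: matrix_vector_mul_assoc M')
  qed (use pos in auto)
  then show thesis
    by (rule that)
qed

theorem theorem1p2:
  fixes M :: "real ^ 'n ^ 'n" and H f u :: "real ^ 'n \<Rightarrow> real"
  assumes "CARD('n) \<ge> 2"
    and "transpose M = M" and "\<And>x. x \<noteq> 0 \<Longrightarrow> (M *v x) \<bullet> x > 0"
    and "\<And>\<xi>. H \<xi> = sqrt ((M *v \<xi>) \<bullet> \<xi>)"
    and "f \<in> Lp_loc 2 UNIV"
    and "u \<in> H1_loc UNIV" and "locally_bounded UNIV u"
    and "weak_solution H UNIV f u"
  shows "D12_far_from_origin (kelvin_transform H u) \<and>
    weak_solution (dual_norm H) (UNIV - {0})
      (\<lambda>y. f (T_map H y) / H y ^ (CARD('n) + 2)) (kelvin_transform H u)"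
proof -
  obtain B where B: "dual_forms ((*v) M) B"
    using symmetric_positive_definite_dual_forms assms(2,3) by blast
  have H: "H = energy_norm ((*v) M)"
    using assms(4) by (simp add: fun_eq_iff energy_norm_def)
  obtain g where g: "has_weak_gradient UNIV u g" "g \<in> Lp_loc 2 UNIV"
    "\<And>\<psi>. \<psi> \<in> C1_c UNIV \<Longrightarrow>
      (LINT x:UNIV|lebesgue. finsler_field H (g x) \<bullet> gradient \<psi> x) = (LINT x:UNIV|lebesgue. f x * \<psi> x)"
    using assms(8) unfolding weak_solution_def by blast
  have u: "u \<in> Lp_loc 2 UNIV"
    using assms(6) by (simp add: H1_loc_def)
  \<comment> \<open>The bound on the dimension makes the subtraction exact, as the locale
    demands.\<close>
  interpret kelvin "(*v) M" B u g "CARD('n) - 2"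
    using B g(1) assms(1) by (simp add: kelvin_def kelvin_axioms_def)
  show ?thesis
    using kelvin_D12_far_from_origin[OF u g(2) assms(7)]
      kelvin_weak_solution[OF u g(2) assms(5), folded H, OF g(3)]
    by (simp add: kelvin_transform_eq[folded H])
qed

end
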